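(* Let $(Z_1,Z_2)$ be a bivariate stationary Gaussian random field on $\mathbb R$ with matrix covariance function $K=(K_{k\ell})_{1\le k,\ell\le 2}$. Assume that, for some $L>0$, each $K_{k\ell}$ satisfies condition $\mathrm A(L,c_{k\ell},\alpha_{k\ell})$ (defined in the context), and that for some $\beta\in\mathbb R$ $$\alpha_{12}=\alpha_{11},\qquad c_{12}=\beta c_{11}.$$ Assume additionally that $\alpha_{11}-1<\alpha_{22}\le\alpha_{11}$. Then the measures on the paths of the bivariate random field $(Z_1,Z_2)$ on $[0,L]$ are orthogonal for different values of $\beta$. In particular, if $p$ is an integer such that $\alpha_{11}<2p$, then $$\hat\beta_n=\mathrm{OLS}^{(p)}_n(Z_2,Z_1)=\frac{\sum_{j=0}^{n-p}\nabla_h^{(p)}Z_1(hj)\,\nabla_h^{(p)}Z_2(hj)}{\sum_{j=0}^{n-p}\{\nabla_h^{(p)}Z_1(hj)\}^2}\;\longrightarrow\;\beta\quad\text{in probability as } n\to\infty,$$ where $h=L/n$.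
   Context: Condition $\mathrm A(L,c,\alpha)$: a (cross-)covariance function $K$ on $\mathbb R$ can be written $K(t)=A(t)+B(t)$, where $A$ is an even analytic function and $B$ is even and continuous on $[-L,L]$; the $k$-th derivative $B^{(k)}$ on $(0,L]$ ($k=0,1,2,\dots$, $B^{(0)}=B$) satisfies, as $t\downarrow0$, $B^{(k)}(t)=(\alpha)_k\,c\,t^{\alpha-k}+o(t^{\alpha-k})$, where $c$ is a constant (non-zero when $K$ is a covariance function, i.e. for $k=\ell$), $\alpha>0$ is not an even integer, and $(\alpha)_k=\Gamma(\alpha+1)/\Gamma(\alpha+1-k)$ is the falling factorial. $K_{k\ell}(t)=\mathrm{Cov}(Z_k(s+t),Z_\ell(s))$. Differences: $\nabla_h^{(0)}Z=Z$, $\nabla_h^{(1)}Z(s)=h^{-1}\{Z(s+h)-Z(s)\}$, $\nabla_h^{(i)}Z=\nabla_h^{(1)}(\nabla_h^{(i-1)}Z)$. The field is observed at the $n+1$ equally spaced points $0,h,\dots,nh=L$. The measure on the paths is the law of the field restricted to $[0,L]$, on the $\sigma$-algebra generated by point evaluations. Two measures $\mathcal P_0,\mathcal P_1$ are orthogonal if there is a measurable set $E$ with $\mathcal P_0(E)=0$, $\mathcal P_1(E)=1$. *)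

theory Defs
  imports "HOL-Probability.Probability"
begin

text \<open>At the poles of the denominator (\<open>\<alpha>\<close> an integer with \<open>\<alpha> < k\<close>) the library has \<open>Gamma = 0\<close>,
  hence the quotient is \<open>0\<close>, which is the right value; see \<open>falling_eq_prod\<close>.\<close>

definition falling :: "real \<Rightarrow> nat \<Rightarrow> real" where
  "falling \<alpha> k = Gamma (\<alpha> + 1) / Gamma (\<alpha> + 1 - real k)"

lemma falling_eq_prod:
  assumes "\<alpha> > 0"
  shows "falling \<alpha> k = (\<Prod>i<k. \<alpha> - real i)"
proof (induction k)
  case 0
  have "Gamma (\<alpha> + 1) \<noteq> 0"
    using Gamma_real_pos[of "\<alpha> + 1"] assms by linarith
  then show ?case by (simp add: falling_def)
next
  case (Suc k)
  have "falling \<alpha> (Suc k) = Gamma (\<alpha> + 1) * rGamma (\<alpha> - real k)"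
    by (simp add: falling_def rGamma_inverse_Gamma divide_inverse)
  also have "rGamma (\<alpha> - real k) = (\<alpha> - real k) * rGamma (\<alpha> + 1 - real k)"
    using rGamma_plus1[of "\<alpha> - real k"] by (simp add: algebra_simps)
  finally have "falling \<alpha> (Suc k) = falling \<alpha> k * (\<alpha> - real k)"
    by (simp add: falling_def rGamma_inverse_Gamma divide_inverse mult.commute)
  then show ?case using Suc by simp
qed

definition real_analytic_on :: "(real \<Rightarrow> real) \<Rightarrow> real set \<Rightarrow> bool" where
  "real_analytic_on f S \<longleftrightarrow>
     (\<forall>x\<in>S. \<exists>r>0. \<exists>a. \<forall>y. \<bar>y - x\<bar> < r \<longrightarrow> (\<lambda>n. a n * (y - x) ^ n) sums f y)"

text \<open>\<open>D k\<close> is the \<open>k\<close>-th derivative of \<open>B\<close> on \<open>(0, L]\<close>, one-sided at \<open>L\<close>. The coefficient \<open>c\<close> may be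
  zero here; see \<open>regression_covariance\<close> for the diagonal entries.\<close>

definition condition_A :: "real \<Rightarrow> real \<Rightarrow> real \<Rightarrow> (real \<Rightarrow> real) \<Rightarrow> bool" where
  "condition_A L c \<alpha> K \<longleftrightarrow>
     \<alpha> > 0 \<and> (\<nexists>m::int. even m \<and> \<alpha> = of_int m) \<and>
     (\<exists>A B D.
        (\<forall>t. K t = A t + B t) \<and>
        real_analytic_on A UNIV \<and> (\<forall>t. A (- t) = A t) \<and>
        continuous_on {-L..L} B \<and> (\<forall>t\<in>{-L..L}. B (- t) = B t) \<and>
        (\<forall>t\<in>{0<..L}. D 0 t = B t) \<and>
        (\<forall>k. \<forall>t\<in>{0<..L}. (D k has_real_derivative D (Suc k) t) (at t within {0<..L})) \<and>
        (\<forall>k. (\<lambda>t. D k t - falling \<alpha> k * c * t powr (\<alpha> - real k))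
               \<in> o[at_right 0](\<lambda>t. t powr (\<alpha> - real k))))"

text \<open>Matrix entries \<open>(k, l)\<close> are \<open>$ k $ l\<close>.\<close>

definition regression_covariance ::
    "real \<Rightarrow> (real \<Rightarrow> real^2^2) \<Rightarrow> real^2^2 \<Rightarrow> real^2^2 \<Rightarrow> real \<Rightarrow> bool" where
  "regression_covariance L K c \<alpha> \<beta> \<longleftrightarrow>
     (\<forall>k l. condition_A L (c $ k $ l) (\<alpha> $ k $ l) (\<lambda>t. K t $ k $ l)) \<and>
     (\<forall>k. c $ k $ k \<noteq> 0) \<and>
     \<alpha> $ 1 $ 2 = \<alpha> $ 1 $ 1 \<and>
     c $ 1 $ 2 = \<beta> * c $ 1 $ 1 \<and>
     \<alpha> $ 1 $ 1 - 1 < \<alpha> $ 2 $ 2 \<and> \<alpha> $ 2 $ 2 \<le> \<alpha> $ 1 $ 1"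

text \<open>Degenerate (almost surely constant) variables count as Gaussian.\<close>

definition gaussian_rv :: "'a measure \<Rightarrow> ('a \<Rightarrow> real) \<Rightarrow> bool" where
  "gaussian_rv M X \<longleftrightarrow>
     X \<in> borel_measurable M \<and>
     (\<exists>\<mu> \<sigma>. (\<sigma> > 0 \<and> distributed M lborel X (\<lambda>x. ennreal (normal_density \<mu> \<sigma> x))) \<or>
            (\<sigma> = 0 \<and> (AE \<omega> in M. X \<omega> = \<mu>)))"

definition gaussian_field :: "'a measure \<Rightarrow> (real \<Rightarrow> 'a \<Rightarrow> real^2) \<Rightarrow> bool" where
  "gaussian_field M Z \<longleftrightarrow>
     (\<forall>s. Z s \<in> borel_measurable M) \<and>
     (\<forall>S a. finite S \<longrightarrow> gaussian_rv M (\<lambda>\<omega>. \<Sum>s\<in>S. a s \<bullet> Z s \<omega>))"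

definition cov :: "'a measure \<Rightarrow> ('a \<Rightarrow> real) \<Rightarrow> ('a \<Rightarrow> real) \<Rightarrow> real" where
  "cov M X Y =
     integral\<^sup>L M (\<lambda>\<omega>. (X \<omega> - integral\<^sup>L M X) * (Y \<omega> - integral\<^sup>L M Y))"

text \<open>The mean is constant but not necessarily zero.\<close>

definition stationary_gaussian_field ::
    "'a measure \<Rightarrow> (real \<Rightarrow> 'a \<Rightarrow> real^2) \<Rightarrow> (real \<Rightarrow> real^2^2) \<Rightarrow> bool" where
  "stationary_gaussian_field M Z K \<longleftrightarrow>
     prob_space M \<and> gaussian_field M Z \<and>
     (\<exists>m::real^2. \<forall>s k. integral\<^sup>L M (\<lambda>\<omega>. Z s \<omega> $ k) = m $ k) \<and>
     (\<forall>s t k l. cov M (\<lambda>\<omega>. Z (s + t) \<omega> $ k) (\<lambda>\<omega>. Z s \<omega> $ l) = K t $ k $ l)"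

definition path_law :: "real \<Rightarrow> 'a measure \<Rightarrow> (real \<Rightarrow> 'a \<Rightarrow> real^2) \<Rightarrow> (real \<Rightarrow> real^2) measure" where
  "path_law L M Z =
     distr M (PiM {0..L} (\<lambda>_. borel)) (\<lambda>\<omega>. \<lambda>s\<in>{0..L}. Z s \<omega>)"

definition orthogonal_measures :: "'b measure \<Rightarrow> 'b measure \<Rightarrow> bool" where
  "orthogonal_measures P Q \<longleftrightarrow>
     sets P = sets Q \<and> (\<exists>E\<in>sets P. emeasure P E = 0 \<and> emeasure Q E = 1)"

definition converges_in_probability ::
    "'a measure \<Rightarrow> (nat \<Rightarrow> 'a \<Rightarrow> real) \<Rightarrow> real \<Rightarrow> bool" where
  "converges_in_probability M X x \<longleftrightarrow>
     (\<forall>n. X n \<in> borel_measurable M) \<and>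
     (\<forall>\<epsilon>>0. (\<lambda>n. measure M {\<omega>\<in>space M. \<bar>X n \<omega> - x\<bar> > \<epsilon>}) \<longlonglongrightarrow> 0)"

definition nabla1 :: "real \<Rightarrow> (real \<Rightarrow> real) \<Rightarrow> (real \<Rightarrow> real)" where
  "nabla1 h z = (\<lambda>s. (z (s + h) - z s) / h)"

definition nabla :: "real \<Rightarrow> nat \<Rightarrow> (real \<Rightarrow> real) \<Rightarrow> (real \<Rightarrow> real)" where
  "nabla h i = nabla1 h ^^ i"

text \<open>The index range is \<open>j = 0, \<dots>, n - p\<close>, empty when \<open>n < p\<close>. The response
  \<open>y\<close> precedes the regressor \<open>x\<close>.\<close>

definition OLS :: "real \<Rightarrow> nat \<Rightarrow> nat \<Rightarrow> (real \<Rightarrow> real) \<Rightarrow> (real \<Rightarrow> real) \<Rightarrow> real" where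
  "OLS L p n y x =
     (let h = L / real n in
      (\<Sum>j<n + 1 - p. nabla h p x (h * real j) * nabla h p y (h * real j)) /
      (\<Sum>j<n + 1 - p. (nabla h p x (h * real j))\<^sup>2))"

end

theory Submission
  imports Defs "HOL-Real_Asymp.Real_Asymp"
begin

text \<open>
  Put \<open>X\<^sub>j = \<nabla>\<^sub>h\<^sup>p Z\<^sub>1(h j)\<close>, \<open>Y\<^sub>j = \<nabla>\<^sub>h\<^sup>p Z\<^sub>2(h j)\<close> and \<open>W\<^sub>j = Y\<^sub>j - \<beta> X\<^sub>j\<close>, so that the error of the estimator
  is \<open>\<Sum> X\<^sub>j W\<^sub>j / \<Sum> X\<^sub>j\<^sup>2\<close>. Covariances of differences are differences of order \<open>2 p\<close> of the
  covariance function: by the mean value theorem they are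
  \<open>O(((m + 1) h) powr (\<alpha> - 2 p))\<close> at lag \<open>m\<close>, and \<open>E X\<^sub>0\<^sup>2\<close> is asymptotically
  a non-zero multiple of \<open>h powr (\<alpha>\<^sub>1\<^sub>1 - 2 p)\<close>, whereas \<open>c\<^sub>1\<^sub>2 = \<beta> c\<^sub>1\<^sub>1\<close> makes \<open>E X\<^sub>0 W\<^sub>0\<close> of smaller
  order. Isserlis' formula turns the variances of both sums into sums of products of
  covariances, which are negligible because \<open>\<alpha>\<^sub>1\<^sub>1 - \<alpha>\<^sub>2\<^sub>2 < 1\<close>. Orthogonality follows from
  consistency with the Borel-Cantelli lemma along a subsequence.
\<close>

section \<open>Finite differences\<close>

text \<open>Away from lag zero only upper bounds are needed; exact asymptotics, and with them the
  cancellation due to \<open>c\<^sub>1\<^sub>2 = \<beta> c\<^sub>1\<^sub>1\<close>, enter at lag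
  zero alone. Two obstacles shape the analysis. At small lags the nodes of a difference meet the
  singularity of the covariance at 0, where no derivative is available; there the terms are bounded
  one by one, and the factor \<open>m + 1\<close> in place of \<open>m\<close> lets one formula
  serve all lags. At lag zero the limit contains a difference of order \<open>2 p\<close> of
  \<open>\<bar>t\<bar> powr \<alpha>\<close>, which must not vanish: this is where even integers are
  excluded, by counting zeros of an exponential sum with Rolle's theorem. The gap condition arises
  as follows. With \<open>a = 2 p - \<alpha>\<^sub>1\<^sub>1\<close> and
  \<open>d = \<alpha>\<^sub>1\<^sub>1 - \<alpha>\<^sub>2\<^sub>2\<close>, products of two
  covariances at lag \<open>m\<close> are bounded by a multiple of
  \<open>((m + 1) h) powr (- (2 a + d))\<close>. Relative to the squared mean of the denominator,
  the double sum is then at most of order \<open>n powr d\<close> times the average of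
  \<open>(m + 1) powr (- (2 a + d))\<close> over the lags. Such an average never decays faster than
  \<open>1 / n\<close>, so the argument requires \<open>d < 1\<close>. Gaussianity enters only
  through fourth moments.\<close>

lemma nabla_0 [simp]: "nabla h 0 f = f"
  by (simp add: nabla_def)

lemma nabla_Suc: "nabla h (Suc q) f = nabla h q (nabla1 h f)"
  by (simp add: nabla_def funpow_swap1)

lemma nabla_Suc': "nabla h (Suc q) f = nabla1 h (nabla h q f)"
  by (simp add: nabla_def)

lemma nabla_add: "nabla h q (\<lambda>t. f t + g t) s = nabla h q f s + nabla h q g s"
proof (induction q arbitrary: s)
  case (Suc q)
  then show ?case by (simp add: nabla_Suc' nabla1_def add_divide_distrib diff_divide_distrib)
qed simp

lemma nabla_const: "q > 0 \<Longrightarrow> nabla h q (\<lambda>t. c) s = 0"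
proof (induction q arbitrary: s)
  case (Suc q)
  then show ?case by (cases "q = 0") (simp_all add: nabla_Suc' nabla1_def)
qed simp

lemma nabla_cong:
  assumes "\<And>i. i \<le> q \<Longrightarrow> f (s + real i * h) = g (s + real i * h)"
  shows "nabla h q f s = nabla h q g s"
  using assms
proof (induction q arbitrary: s)
  case (Suc q)
  have "nabla h q f (s + h) = nabla h q g (s + h)"
  proof (rule Suc.IH)
    fix i assume "i \<le> q"
    then show "f (s + h + real i * h) = g (s + h + real i * h)"
      using Suc.prems[of "Suc i"] by (simp add: algebra_simps)
  qed
  moreover have "nabla h q f s = nabla h q g s"
    by (rule Suc.IH) (use Suc.prems in auto)
  ultimately show ?case by (simp add: nabla_Suc' nabla1_def)
qed (use assms[of 0] in simp)

text \<open>The sign \<open>(-1) ^ (q + k)\<close> stands for \<open>(-1) ^ (q - k)\<close> without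
  truncated subtraction. Once the signs are absorbed into \<open>g\<close>, the induction step is
  Pascal's rule.\<close>

lemma nabla_eq_sum:
  "nabla h q f s = (\<Sum>k\<le>q. (-1) ^ (q + k) * real (q choose k) * f (s + real k * h)) / h ^ q"
proof (induction q arbitrary: s)
  case (Suc q)
  define g where "g k = (-1) ^ (Suc q + k) * f (s + real k * h)" for k
  have A: "(\<Sum>k\<le>q. (-1) ^ (q + k) * real (q choose k) * f (s + real k * h)) =
      - (\<Sum>k\<le>q. real (q choose k) * g k)"
    by (simp add: g_def sum_negf[symmetric] algebra_simps)
  have B: "(\<Sum>k\<le>q. (-1) ^ (q + k) * real (q choose k) * f (s + h + real k * h)) =
      (\<Sum>k\<le>q. real (q choose k) * g (Suc k))"
    by (simp add: g_def algebra_simps)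
  have C: "(\<Sum>k\<le>Suc q. real (Suc q choose k) * g k) =
      (\<Sum>k\<le>q. real (q choose k) * g (Suc k)) + (\<Sum>k\<le>q. real (q choose k) * g k)"
  proof -
    have "(\<Sum>k\<le>Suc q. real (Suc q choose k) * g k) =
        g 0 + (\<Sum>k\<le>q. real (Suc q choose Suc k) * g (Suc k))"
      by (subst sum.atMost_Suc_shift) simp
    also have "(\<Sum>k\<le>q. real (Suc q choose Suc k) * g (Suc k)) =
        (\<Sum>k\<le>q. real (q choose k) * g (Suc k)) + (\<Sum>k\<le>q. real (q choose Suc k) * g (Suc k))"
      by (simp add: algebra_simps sum.distrib)
    also have "g 0 + (\<dots>) = (\<Sum>k\<le>q. real (q choose k) * g (Suc k)) +
        (\<Sum>k\<le>Suc q. real (q choose k) * g k)"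
      by (subst sum.atMost_Suc_shift) simp
    finally show ?thesis by simp
  qed
  have "nabla h (Suc q) f s = ((\<Sum>k\<le>q. real (q choose k) * g (Suc k)) +
      (\<Sum>k\<le>q. real (q choose k) * g k)) / h ^ Suc q"
    by (simp only: nabla_Suc' nabla1_def Suc.IH A B) (simp add: add_divide_distrib mult.commute)
  also have "\<dots> = (\<Sum>k\<le>Suc q. real (Suc q choose k) * g k) / h ^ Suc q"
    by (simp only: C)
  finally show ?case by (simp add: g_def algebra_simps)
qed simp

text \<open>Iterated mean value theorem. The induction replaces \<open>D\<close> by the family
  \<open>E\<close> of its difference quotients on the shorter interval \<open>{a..b-h}\<close>; the
  top member of \<open>E\<close> is bounded by the mean value inequality. Derivatives within
  \<open>{a..b}\<close> suffice, which matters at the end point \<open>L\<close>, where condition A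
  gives only one-sided ones.\<close>

lemma abs_nabla_le:
  fixes D :: "nat \<Rightarrow> real \<Rightarrow> real"
  assumes "h > 0" "a \<le> s" "s + real q * h \<le> b"
    and "\<And>k t. k < q \<Longrightarrow> t \<in> {a..b} \<Longrightarrow> (D k has_real_derivative D (Suc k) t) (at t within {a..b})"
    and "\<And>t. t \<in> {a..b} \<Longrightarrow> \<bar>D q t\<bar> \<le> C"
  shows "\<bar>nabla h q (D 0) s\<bar> \<le> C"
  using assms
proof (induction q arbitrary: b D)
  case 0
  then show ?case by simp
next
  case (Suc q)
  define E where "E k t = (D k (t + h) - D k t) / h" for k t
  have "\<bar>nabla h q (E 0) s\<bar> \<le> C"
  proof (rule Suc.IH)
    show "s + real q * h \<le> b - h" using Suc.prems(3) by (simp add: algebra_simps)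
    fix k t assume k: "k < q" and t: "t \<in> {a..b-h}"
    have 1: "(D k has_real_derivative D (Suc k) t) (at t within {a..b-h})"
      by (rule DERIV_subset[OF Suc.prems(4)]) (use k t \<open>h > 0\<close> in auto)
    have 2: "(D k has_real_derivative D (Suc k) (t+h)) (at (t+h) within (\<lambda>t. t+h) ` {a..b-h})"
      by (rule DERIV_subset[OF Suc.prems(4)]) (use k t \<open>h > 0\<close> in auto)
    have "((\<lambda>t. D k (t+h)) has_real_derivative D (Suc k) (t+h) * 1) (at t within {a..b-h})"
      by (rule DERIV_image_chain[of "D k" _ "\<lambda>t. t + h", unfolded o_def, OF 2])
         (auto intro!: derivative_eq_intros)
    then show "(E k has_real_derivative E (Suc k) t) (at t within {a..b-h})"
      unfolding E_def using 1 by (intro DERIV_cdivide DERIV_diff) auto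
  next
    fix t assume t: "t \<in> {a..b-h}"
    have "norm (D q (t+h) - D q t) \<le> C * norm (t + h - t)"
      by (rule field_differentiable_bound[of "{a..b}" "D q" "D (Suc q)"])
         (use Suc.prems t in \<open>auto\<close>)
    then show "\<bar>E q t\<bar> \<le> C" using \<open>h > 0\<close> by (simp add: E_def field_simps)
  qed (use Suc.prems in auto)
  moreover have "nabla1 h (D 0) = E 0" by (auto simp: E_def nabla1_def)
  ultimately show ?case by (simp add: nabla_Suc)
qed

section \<open>Differences of powers\<close>

text \<open>Rolle's theorem between neighbouring zeros, splitting off the largest one. The location
  of \<open>T\<close> strictly between \<open>Min S\<close> and \<open>Max S\<close> is carried
  along so that the zero added beyond \<open>Max S'\<close> is new.\<close>

lemma zeros_of_derivative:
  fixes f :: "real \<Rightarrow> real"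
  assumes "\<And>x. (f has_real_derivative f' x) (at x)"
    and "finite S" "card S = Suc n" "\<And>x. x \<in> S \<Longrightarrow> f x = 0"
  shows "\<exists>T. finite T \<and> card T = n \<and> (\<forall>x\<in>T. f' x = 0 \<and> Min S < x \<and> x < Max S)"
  using assms(2-)
proof (induction n arbitrary: S)
  case 0
  then show ?case by (intro exI[of _ "{}"]) auto
next
  case (Suc n)
  define S' where "S' = S - {Max S}"
  have ne: "S \<noteq> {}" using Suc.prems by auto
  have mem: "Max S \<in> S" using ne Suc.prems by auto
  have S': "finite S'" "card S' = Suc n" "\<And>x. x \<in> S' \<Longrightarrow> f x = 0"
    using Suc.prems mem by (auto simp: S'_def)
  obtain T where T: "finite T" "card T = n" "\<forall>x\<in>T. f' x = 0 \<and> Min S' < x \<and> x < Max S'"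
    using Suc.IH[OF S'] by blast
  have ne': "S' \<noteq> {}" using S' by auto
  have m': "Max S' \<in> S'" using S' ne' by auto
  have lt: "Max S' < Max S"
    using m' Suc.prems(1) by (metis Diff_iff Max_ge S'_def insertCI order_le_imp_less_or_eq)
  have mm: "Min S' = Min S"
  proof (rule Min_eqI[symmetric])
    show "Min S' \<in> S" using Min_in[OF S'(1) ne'] by (auto simp: S'_def)
    fix y assume "y \<in> S"
    then show "Min S' \<le> y"
      using lt Min_le[OF S'(1), of y] Min_le[OF S'(1) m'] by (cases "y = Max S") (auto simp: S'_def)
  qed fact
  have "\<exists>z. Max S' < z \<and> z < Max S \<and> f' z = 0"
  proof -
    have "f (Max S') = f (Max S)" using S'(3)[OF m'] Suc.prems(3)[OF mem] by simp
    moreover have "continuous_on {Max S'..Max S} f"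
      using assms(1) by (meson DERIV_continuous_on has_field_derivative_at_within)
    ultimately obtain z where z: "Max S' < z" "z < Max S" "(f has_real_derivative 0) (at z)"
      using Rolle[OF lt] assms(1) real_differentiable_def by (metis has_field_derivative_def real_differentiableE)
    then show ?thesis using DERIV_unique[OF assms(1) z(3)] by blast
  qed
  then obtain z where z: "Max S' < z" "z < Max S" "f' z = 0" by blast
  have "Min S \<le> Max S'" using mm Min_le[OF S'(1) m'] by simp
  then show ?case
    using T z lt mm by (intro exI[of _ "insert z T"]) (force simp: card_insert_if)
qed

text \<open>Dividing by \<open>exp (e j * x)\<close> makes the term of \<open>j\<close> constant;
  differentiating removes it at the cost of one zero, so the number of zeros and the number of terms
  fall together. The remaining coefficients acquire the non-zero factors
  \<open>e i - e j\<close>.\<close>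

lemma exp_sum_eq_0_imp_coeffs_0:
  fixes b :: "'i \<Rightarrow> real" and e :: "'i \<Rightarrow> real"
  assumes "finite I" "inj_on e I" "finite S" "card S = card I"
    and "\<And>x. x \<in> S \<Longrightarrow> (\<Sum>i\<in>I. b i * exp (e i * x)) = 0" "i \<in> I"
  shows "b i = 0"
  using assms
proof (induction I arbitrary: b e S i rule: finite_induct)
  case empty
  then show ?case by simp
next
  case (insert j I)
  define f where "f x = b j + (\<Sum>i\<in>I. b i * exp ((e i - e j) * x))" for x
  define f' where "f' x = (\<Sum>i\<in>I. (b i * (e i - e j)) * exp ((e i - e j) * x))" for x
  have f: "f x = exp (- e j * x) * (\<Sum>i\<in>insert j I. b i * exp (e i * x))" for x
    using insert.hyps by (simp add: f_def sum_distrib_left mult_exp_exp algebra_simps exp_diff exp_minus divide_inverse)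
  have fz: "f x = 0" if "x \<in> S" for x
    using insert.prems(4)[OF that] f by simp
  have "(f has_real_derivative f' x) (at x)" for x
    unfolding f_def f'_def by (auto intro!: derivative_eq_intros sum.cong)
  then obtain T where T: "finite T" "card T = card I" "\<forall>x\<in>T. f' x = 0"
    using zeros_of_derivative[of f f' S "card I"] insert.prems insert.hyps fz by auto
  have bI: "b i = 0" if "i \<in> I" for i
  proof -
    have "b i * (e i - e j) = 0"
    proof (rule insert.IH[where b = "\<lambda>i. b i * (e i - e j)" and e = "\<lambda>i. e i - e j" and S = T])
      show "inj_on (\<lambda>i. e i - e j) I"
        using insert.prems(1) by (auto simp: inj_on_def)
    qed (use T that in \<open>simp_all add: f'_def\<close>)
    moreover have "e i \<noteq> e j"
      using insert.prems(1) insert.hyps that by (auto simp: inj_on_def)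
    ultimately show ?thesis by simp
  qed
  have "S \<noteq> {}" using insert.prems insert.hyps by auto
  then obtain x where "x \<in> S" by blast
  then have "b j = 0" using fz[of x] bI by (simp add: f_def)
  then show ?case using bI insert.prems by auto
qed

text \<open>This is the central difference of order \<open>2 * p\<close> with step 1 of
  \<open>\<bar>t\<bar> powr \<alpha>\<close> at 0, that is, \<open>nabla 1 (2 * p)\<close> of that
  function at \<open>- real p\<close>.\<close>

definition power_difference :: "nat \<Rightarrow> real \<Rightarrow> real" where
  "power_difference p \<alpha> =
     (\<Sum>k\<le>2*p. (-1) ^ k * real (2*p choose k) * \<bar>real k - real p\<bar> powr \<alpha>)"

text \<open>The terms of \<open>k\<close> and \<open>2 * p - k\<close> agree, hence the factor 2,
  and the middle one vanishes because \<open>0 powr \<alpha> = 0\<close>. The resulting exponents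
  \<open>ln i\<close> are distinct, as the counting of zeros requires.\<close>

lemma power_difference_eq_exp_sum:
  "power_difference p \<alpha> =
     (\<Sum>i\<in>{1..p}. (2 * (-1) ^ (p + i) * real (2*p choose (p + i))) * exp (ln (real i) * \<alpha>))"
proof -
  define g where "g k = (-1) ^ k * real (2*p choose k) * \<bar>real k - real p\<bar> powr \<alpha>" for k
  define b where "b i = (-1) ^ (p + i) * real (2*p choose (p + i)) * exp (ln (real i) * \<alpha>)" for i
  have "{..2*p} = ({..<p} \<union> {p}) \<union> {p+1..2*p}" by auto
  then have "sum g {..2*p} = sum g {..<p} + g p + sum g {p+1..2*p}"
    by (simp only:) (subst sum.union_disjoint; auto)+
  also have "g p = 0" by (simp add: g_def)
  also have "sum g {p+1..2*p} = sum b {1..p}"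
    by (rule sum.reindex_bij_witness[of _ "\<lambda>i. p + i" "\<lambda>k. k - p"])
       (auto simp: g_def b_def powr_def mult.commute)
  also have "sum g {..<p} = sum b {1..p}"
  proof (rule sum.reindex_bij_witness[of _ "\<lambda>i. p - i" "\<lambda>k. p - k"])
    fix k assume k: "k \<in> {..<p}"
    have "even (k + (p + (p - k)))" using k by auto
    then have "(-1::real) ^ k = (-1) ^ (p + (p - k))" by (metis even_add neg_one_even_power neg_one_odd_power)
    moreover have "2*p choose k = (2*p choose (p + (p - k)))"
      using binomial_symmetric[of k "2*p"] k by (simp add: mult_2)
    ultimately show "b (p - k) = g k"
      using k by (simp add: g_def b_def powr_def mult.commute of_nat_diff)
  qed auto
  finally show ?thesis
    unfolding power_difference_def g_def[symmetric] b_def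
    by (simp add: sum_distrib_left sum.distrib[symmetric] algebra_simps)
qed

lemma pderiv_funpow_eq_0:
  fixes P :: "real poly"
  shows "degree P < k \<Longrightarrow> (pderiv ^^ k) P = 0"
proof (induction k arbitrary: P)
  case (Suc k)
  have Z: "(pderiv ^^ k) (0 :: real poly) = 0" by (induction k) auto
  show ?case
  proof (cases "degree P = 0")
    case True
    then have "pderiv P = 0" by (simp add: pderiv_eq_0_iff)
    then show ?thesis using Z by (simp only: funpow_Suc_right o_apply)
  next
    case False
    then have "degree (pderiv P) < k" using Suc.prems by (simp add: degree_pderiv)
    then show ?thesis using Suc.IH by (simp only: funpow_Suc_right o_apply)
  qed
qed simp

text \<open>This is \<open>abs_nabla_le\<close> with bound 0: the derivative of order
  \<open>q\<close> of a polynomial of smaller degree is zero.\<close>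

lemma nabla_power_eq_0:
  assumes "m < q" "h > 0"
  shows "nabla h q (\<lambda>t. t ^ m) s = 0"
proof -
  define P where "P = (monom 1 m :: real poly)"
  have "\<bar>nabla h q ((\<lambda>k. poly ((pderiv ^^ k) P)) 0) s\<bar> \<le> 0"
  proof (rule abs_nabla_le[of h s s q "s + real q * h"])
    have "(pderiv ^^ q) P = 0"
      by (rule pderiv_funpow_eq_0) (use assms in \<open>simp add: P_def degree_monom_eq\<close>)
    then show "\<bar>poly ((pderiv ^^ q) P) t\<bar> \<le> 0" for t by simp
  qed (use assms in \<open>auto intro!: has_field_derivative_at_within poly_DERIV\<close>)
  moreover have "poly P = (\<lambda>t. t ^ m)" by (auto simp: P_def poly_monom)
  ultimately show ?thesis by simp
qed

text \<open>As a function of \<open>\<alpha>\<close> this is an exponential sum with \<open>p\<close> terms, so it has no positive zeros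
  besides the \<open>p - 1\<close> exponents \<open>2, 4, \<dots>, 2 p - 2\<close> annihilated by differences of order \<open>2 p\<close>.\<close>

lemma power_difference_nonzero:
  assumes "p > 0" "\<alpha> > 0" "\<And>i::nat. \<alpha> \<noteq> 2 * real i"
  shows "power_difference p \<alpha> \<noteq> 0"
proof
  assume z: "power_difference p \<alpha> = 0"
  define S where "S = insert \<alpha> ((\<lambda>i::nat. 2 * real i) ` {1..<p})"
  have c: "card S = card {1..p}"
    unfolding S_def using assms by (subst card_insert_disjoint) (auto simp: card_image inj_on_def)
  have even: "power_difference p (2 * real i) = 0" if "i \<in> {1..<p}" for i
  proof -
    have pw: "\<bar>y\<bar> powr (2 * real i) = y ^ (2 * i)" for y :: real
    proof -
      have "\<bar>y\<bar> powr (2 * real i) = \<bar>y\<bar> powr real (2 * i)" by simp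
      also have "\<dots> = \<bar>y\<bar> ^ (2 * i)" by (subst powr_realpow') (use that in auto)
      finally show ?thesis by (simp add: power_mult)
    qed
    have "power_difference p (2 * real i) = nabla 1 (2 * p) (\<lambda>t. t ^ (2 * i)) (- real p)"
      by (simp add: power_difference_def nabla_eq_sum pw power_add add.commute[of "- real p"])
    then show ?thesis using nabla_power_eq_0[of "2*i" "2*p" 1] that by simp
  qed
  \<comment> \<open>The sum has \<open>p\<close> terms and vanishes at the \<open>p\<close> points
    of \<open>S\<close>, so all its coefficients are 0. The one of \<open>i = p\<close> is plainly
    2, a contradiction.\<close>
  have "2 * (-1) ^ (p + p) * real (2*p choose (p + p)) = 0"
  proof (rule exp_sum_eq_0_imp_coeffs_0[where I = "{1..p}" and e = "\<lambda>i. ln (real i)" and S = S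
        and b = "\<lambda>i. 2 * (-1) ^ (p + i) * real (2*p choose (p + i))" and i = p])
    show "inj_on (\<lambda>i. ln (real i)) {1..p}" by (auto simp: inj_on_def)
    fix x assume "x \<in> S"
    then have "power_difference p x = 0" using z even by (auto simp: S_def)
    then show "(\<Sum>i\<in>{1..p}. 2 * (-1) ^ (p + i) * real (2*p choose (p + i)) * exp (ln (real i) * x)) = 0"
      by (simp add: power_difference_eq_exp_sum)
  qed (use assms c in \<open>auto simp: S_def\<close>)
  then show False by (simp add: mult_2)
qed

section \<open>Covariance functions satisfying condition A\<close>

text \<open>Termwise differentiation keeps the centre and the radius of each local expansion, so the
  derivative is again analytic; a choice function for this step is then iterated.\<close>

lemma real_analytic_on_higher_derivs:
  assumes "real_analytic_on A UNIV"
  shows "\<exists>D. D 0 = A \<and> (\<forall>k t. (D k has_real_derivative D (Suc k) t) (at t))"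
proof -
  have step: "\<exists>g. real_analytic_on g UNIV \<and> (\<forall>t. (f has_real_derivative g t) (at t))"
    if f: "real_analytic_on f UNIV" for f
  proof -
    have loc: "\<exists>r>0. \<exists>b. \<forall>y. \<bar>y - x\<bar> < r \<longrightarrow>
        (f has_real_derivative (\<Sum>n. b n * (y - x) ^ n)) (at y) \<and> summable (\<lambda>n. b n * (y - x) ^ n)" for x
    proof -
      obtain r a where r: "r > 0" and a: "\<And>y. \<bar>y - x\<bar> < r \<Longrightarrow> (\<lambda>n. a n * (y - x) ^ n) sums f y"
        using f unfolding real_analytic_on_def by blast
      have sa: "summable (\<lambda>n. a n * z ^ n)" if "norm z < r" for z
        using a[of "x + z"] that by (auto simp: sums_iff)
      have "(f has_real_derivative (\<Sum>n. diffs a n * (y - x) ^ n)) (at y) \<and>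
          summable (\<lambda>n. diffs a n * (y - x) ^ n)" if y: "\<bar>y - x\<bar> < r" for y
      proof
        have "((\<lambda>z. \<Sum>n. a n * z ^ n) has_real_derivative (\<Sum>n. diffs a n * (y - x) ^ n)) (at (y - x))"
          by (rule termdiffs_strong'[OF sa]) (use y in auto)
        then have "((\<lambda>z. \<Sum>n. a n * (z - x) ^ n) has_real_derivative (\<Sum>n. diffs a n * (y - x) ^ n)) (at y)"
          using DERIV_shift[of "\<lambda>z. \<Sum>n. a n * z ^ n" _ y "- x"] by simp
        then show "(f has_real_derivative (\<Sum>n. diffs a n * (y - x) ^ n)) (at y)"
        proof (rule has_field_derivative_transform_within_open[where S = "ball x r"])
          show "y \<in> ball x r" using y by (simp add: dist_real_def)
          fix z assume "z \<in> ball x r"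
          then show "(\<Sum>n. a n * (z - x) ^ n) = f z"
            using a[of z] by (auto simp: dist_real_def sums_iff abs_minus_commute)
        qed auto
        show "summable (\<lambda>n. diffs a n * (y - x) ^ n)"
          by (rule termdiff_converges[OF _ sa]) (use y in auto)
      qed
      then show ?thesis using r by blast
    qed
    define g where "g = deriv f"
    have 1: "(f has_real_derivative g t) (at t)" for t
    proof -
      obtain r b where "r > 0" "\<forall>y. \<bar>y - t\<bar> < r \<longrightarrow> (f has_real_derivative (\<Sum>n. b n * (y - t) ^ n)) (at y)"
        using loc[of t] by blast
      then have "\<exists>d. (f has_real_derivative d) (at t)" by force
      then show ?thesis unfolding g_def using DERIV_imp_deriv by blast
    qed
    have "real_analytic_on g UNIV"
      unfolding real_analytic_on_def
    proof
      fix x :: real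
      obtain r b where r: "r > 0" and b: "\<forall>y. \<bar>y - x\<bar> < r \<longrightarrow>
          (f has_real_derivative (\<Sum>n. b n * (y - x) ^ n)) (at y) \<and> summable (\<lambda>n. b n * (y - x) ^ n)"
        using loc by blast
      have "\<forall>y. \<bar>y - x\<bar> < r \<longrightarrow> (\<lambda>n. b n * (y - x) ^ n) sums g y"
      proof (intro allI impI)
        fix y assume "\<bar>y - x\<bar> < r"
        with b have "g y = (\<Sum>n. b n * (y - x) ^ n)" "summable (\<lambda>n. b n * (y - x) ^ n)"
          using DERIV_unique[OF 1[of y]] by auto
        then show "(\<lambda>n. b n * (y - x) ^ n) sums g y" by (simp add: sums_iff)
      qed
      with r show "\<exists>r>0. \<exists>a. \<forall>y. \<bar>y - x\<bar> < r \<longrightarrow> (\<lambda>n. a n * (y - x) ^ n) sums g y" by blast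
    qed
    with 1 show ?thesis by blast
  qed
  obtain F where F: "\<And>f. real_analytic_on f UNIV \<Longrightarrow>
      real_analytic_on (F f) UNIV \<and> (\<forall>t. (f has_real_derivative F f t) (at t))"
    using step by metis
  have "real_analytic_on ((F ^^ k) A) UNIV" for k
    by (induction k) (use assms F in auto)
  then show ?thesis
    using F by (intro exI[of _ "\<lambda>k. (F ^^ k) A"]) auto
qed

text \<open>The constant does not depend on the mesh: it is the maximum on \<open>{-L..L}\<close> of
  the derivative of order \<open>q\<close>.\<close>

lemma nabla_analytic_bounded:
  assumes "real_analytic_on A UNIV"
  shows "\<exists>C. \<forall>h s. h > 0 \<longrightarrow> - L \<le> s \<longrightarrow> s + real q * h \<le> L \<longrightarrow> \<bar>nabla h q A s\<bar> \<le> C"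
proof -
  obtain D where D0: "D 0 = A" and D: "\<And>k t. (D k has_real_derivative D (Suc k) t) (at t)"
    using real_analytic_on_higher_derivs[OF assms] by blast
  have "continuous_on {-L..L} (D q)"
    using D by (meson DERIV_continuous_on has_field_derivative_at_within)
  then have "bounded (D q ` {-L..L})"
    by (intro compact_imp_bounded compact_continuous_image) auto
  then obtain C where C: "\<And>t. t \<in> {-L..L} \<Longrightarrow> \<bar>D q t\<bar> \<le> C"
    unfolding bounded_iff by (metis imageI real_norm_def)
  show ?thesis
  proof (intro exI allI impI)
    fix h s assume "h > 0" "- L \<le> s" "s + real q * h \<le> L"
    then show "\<bar>nabla h q A s\<bar> \<le> C"
      using abs_nabla_le[of h "-L" s q L D C] C D D0 by (auto intro: has_field_derivative_at_within)
  qed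
qed

text \<open>Extends an asymptotic at 0 to the whole interval: below \<open>e\<close> the error is at
  most \<open>t powr \<gamma>\<close>, and on \<open>{e/2..L}\<close> the quotient is bounded by
  compactness.\<close>

lemma smallo_powr_bound:
  fixes g :: "real \<Rightarrow> real"
  assumes "L > 0" "continuous_on {0<..L} g"
    and "(\<lambda>t. g t - a * t powr \<gamma>) \<in> o[at_right 0](\<lambda>t. t powr \<gamma>)"
  shows "\<exists>C\<ge>0. \<forall>t\<in>{0<..L}. \<bar>g t\<bar> \<le> C * t powr \<gamma>"
proof -
  have "\<forall>\<^sub>F t in at_right 0. norm (g t - a * t powr \<gamma>) \<le> 1 * norm (t powr \<gamma>)"
    by (rule landau_o.smallD[OF assms(3)]) simp
  then obtain e where e: "e > 0" "\<And>t. 0 < t \<Longrightarrow> t < e \<Longrightarrow> \<bar>g t - a * t powr \<gamma>\<bar> \<le> t powr \<gamma>"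
    unfolding eventually_at_right_field by auto
  have "continuous_on {e/2..L} g"
    by (rule continuous_on_subset[OF assms(2)]) (use e in auto)
  moreover have "continuous_on {e/2..L} (\<lambda>t. t powr \<gamma>)"
    by (rule continuous_on_powr) (use e in \<open>auto intro: continuous_intros\<close>)
  ultimately have "continuous_on {e/2..L} (\<lambda>t. g t / t powr \<gamma>)"
    by (rule continuous_on_divide) (use e in auto)
  then have "compact ((\<lambda>t. g t / t powr \<gamma>) ` {e/2..L})"
    by (rule compact_continuous_image) auto
  then have "bounded ((\<lambda>t. g t / t powr \<gamma>) ` {e/2..L})" by (rule compact_imp_bounded)
  then obtain C where "\<forall>x\<in>(\<lambda>t. g t / t powr \<gamma>) ` {e/2..L}. norm x \<le> C"
    unfolding bounded_iff by blast
  then have C: "\<And>t. t \<in> {e/2..L} \<Longrightarrow> \<bar>g t / t powr \<gamma>\<bar> \<le> C" by auto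
  have "\<bar>g t\<bar> \<le> (\<bar>C\<bar> + \<bar>a\<bar> + 1) * t powr \<gamma>" if t: "t \<in> {0<..L}" for t
  proof (cases "t < e")
    case True
    have "\<bar>g t\<bar> \<le> \<bar>g t - a * t powr \<gamma>\<bar> + \<bar>a * t powr \<gamma>\<bar>" by linarith
    also have "\<dots> \<le> t powr \<gamma> + \<bar>a\<bar> * t powr \<gamma>" using e(2)[of t] True t by (simp add: abs_mult)
    also have "\<dots> \<le> (\<bar>C\<bar> + \<bar>a\<bar> + 1) * t powr \<gamma>" by (simp add: algebra_simps)
    finally show ?thesis .
  next
    case False
    then have "t \<in> {e/2..L}" using t e by auto
    then have "\<bar>g t\<bar> / t powr \<gamma> \<le> C" using C[of t] by simp
    then have "\<bar>g t\<bar> \<le> C * t powr \<gamma>" using t by (simp add: pos_divide_le_eq)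
    also have "\<dots> \<le> (\<bar>C\<bar> + \<bar>a\<bar> + 1) * t powr \<gamma>" by (intro mult_right_mono) auto
    finally show ?thesis .
  qed
  then show ?thesis by (intro exI[of _ "\<bar>C\<bar> + \<bar>a\<bar> + 1"]) auto
qed

lemma condition_A_even:
  assumes "condition_A L c \<alpha> K" "t \<in> {-L..L}"
  shows "K (- t) = K t"
proof -
  obtain A B where "\<forall>t. K t = A t + B t" "\<forall>t. A (- t) = A t" "\<forall>t\<in>{-L..L}. B (- t) = B t"
    using assms(1) unfolding condition_A_def by (elim conjE exE) (rule that)
  then show ?thesis using assms(2) by simp
qed

text \<open>Condition A in the form used below: the asymptotics become bounds on all of
  \<open>{0<..L}\<close>, and evenness extends the one for \<open>B\<close> to
  \<open>{-L..L}\<close>. Continuity at 0 together with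
  \<open>t powr \<alpha> \<longlonglongrightarrow> 0\<close> forces \<open>B 0 = 0\<close>.\<close>

lemma condition_A_decomp:
  assumes "L > 0" "condition_A L c \<alpha> K"
  obtains A B C D where
    "\<forall>t. K t = A t + B t" "real_analytic_on A UNIV"
    "\<forall>t\<in>{-L..L}. B (- t) = B t" "B 0 = 0" "C \<ge> 0"
    "\<forall>t\<in>{-L..L}. \<bar>B t\<bar> \<le> C * \<bar>t\<bar> powr \<alpha>"
    "((\<lambda>t. B t / t powr \<alpha>) \<longlongrightarrow> c) (at_right 0)"
    "\<forall>t\<in>{0<..L}. D 0 t = B t"
    "\<forall>k. \<forall>t\<in>{0<..L}. (D k has_real_derivative D (Suc k) t) (at t within {0<..L})"
    "\<forall>k. \<exists>C\<ge>0. \<forall>t\<in>{0<..L}. \<bar>D k t\<bar> \<le> C * t powr (\<alpha> - real k)"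
proof -
  obtain A B D where raw: "\<forall>t. K t = A t + B t" "real_analytic_on A UNIV"
      "continuous_on {-L..L} B" "\<forall>t\<in>{-L..L}. B (- t) = B t"
      "\<forall>t\<in>{0<..L}. D 0 t = B t"
      "\<forall>k. \<forall>t\<in>{0<..L}. (D k has_real_derivative D (Suc k) t) (at t within {0<..L})"
      "\<forall>k. (\<lambda>t. D k t - falling \<alpha> k * c * t powr (\<alpha> - real k))
               \<in> o[at_right 0](\<lambda>t. t powr (\<alpha> - real k))"
    using assms(2) unfolding condition_A_def by (elim conjE exE) (rule that)
  then have AB: "\<And>t. K t = A t + B t" "real_analytic_on A UNIV"
      "continuous_on {-L..L} B" "\<And>t. t \<in> {-L..L} \<Longrightarrow> B (- t) = B t"
      "\<And>t. t \<in> {0<..L} \<Longrightarrow> D 0 t = B t"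
    by auto
  have dD: "(D k has_real_derivative D (Suc k) t) (at t within {0<..L})" if "t \<in> {0<..L}" for k t
    using raw(6) that by blast
  have oD: "(\<lambda>t. D k t - falling \<alpha> k * c * t powr (\<alpha> - real k))
               \<in> o[at_right 0](\<lambda>t. t powr (\<alpha> - real k))" for k
    using raw(7) by blast
  have \<alpha>: "\<alpha> > 0" using assms(2) by (simp add: condition_A_def)
  have cD: "continuous_on {0<..L} (D k)" for k
    using dD by (meson DERIV_continuous_on)
  have bD: "\<exists>C\<ge>0. \<forall>t\<in>{0<..L}. \<bar>D k t\<bar> \<le> C * t powr (\<alpha> - real k)" for k
    by (rule smallo_powr_bound[OF assms(1) cD oD])
  obtain C where C: "C \<ge> 0" "\<And>t. t \<in> {0<..L} \<Longrightarrow> \<bar>D 0 t\<bar> \<le> C * t powr \<alpha>"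
    using bD[of 0] by auto
  have evL: "\<forall>\<^sub>F t in at_right 0. t \<in> {0<..L}"
    unfolding eventually_at_right_field using assms(1) by (intro exI[of _ L]) auto
  have f0: "falling \<alpha> 0 = 1" using falling_eq_prod[OF \<alpha>, of 0] by simp
  have lim: "((\<lambda>t. B t / t powr \<alpha>) \<longlongrightarrow> c) (at_right 0)"
  proof -
    have "((\<lambda>t. (D 0 t - c * t powr \<alpha>) / t powr \<alpha>) \<longlongrightarrow> 0) (at_right 0)"
      using smalloD_tendsto[OF oD[of 0]] f0 by simp
    then have "((\<lambda>t. (D 0 t - c * t powr \<alpha>) / t powr \<alpha> + c) \<longlongrightarrow> 0 + c) (at_right 0)"
      by (intro tendsto_add tendsto_const)
    moreover have "\<forall>\<^sub>F t in at_right 0. (D 0 t - c * t powr \<alpha>) / t powr \<alpha> + c = B t / t powr \<alpha>"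
      using evL by eventually_elim (use AB(5) in \<open>auto simp: field_simps\<close>)
    ultimately show ?thesis using Lim_transform_eventually by fastforce
  qed
  have B0: "B 0 = 0"
  proof -
    have "(B \<longlongrightarrow> B 0) (at 0 within {-L..L})"
      using AB(3) assms(1) by (simp add: continuous_on)
    then have "(B \<longlongrightarrow> B 0) (at 0 within {0..L})"
      by (rule tendsto_within_subset) auto
    then have 1: "(B \<longlongrightarrow> B 0) (at_right 0)"
      using assms(1) by (simp add: at_within_Icc_at_right)
    have "((\<lambda>t. B t / t powr \<alpha> * t powr \<alpha>) \<longlongrightarrow> c * 0) (at_right 0)"
    proof (rule tendsto_mult[OF lim])
      show "((\<lambda>t::real. t powr \<alpha>) \<longlongrightarrow> 0) (at_right 0)" using \<alpha> by real_asymp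
    qed
    moreover have "\<forall>\<^sub>F t in at_right 0. B t / t powr \<alpha> * t powr \<alpha> = B t"
      using evL by eventually_elim auto
    ultimately have 2: "(B \<longlongrightarrow> 0) (at_right 0)"
      using Lim_transform_eventually by fastforce
    show ?thesis using tendsto_unique[OF _ 1 2] by simp
  qed
  have bB: "\<bar>B t\<bar> \<le> C * \<bar>t\<bar> powr \<alpha>" if "t \<in> {-L..L}" for t
  proof -
    consider "t = 0" | "t > 0" | "t < 0" by linarith
    then show ?thesis
      using C(2)[of t] C(2)[of "-t"] AB(4)[of t] AB(5)[of t] AB(5)[of "-t"] that B0
      by cases auto
  qed
  show thesis
    by (rule that[of A B C D]) (use AB B0 C(1) bB lim dD bD in auto)
qed

text \<open>The nodes run from \<open>(m - p) h\<close> to \<open>(m + p) h\<close>, and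
  \<open>m + p \<le> n\<close> keeps them in \<open>{-L..L}\<close>. Beyond lag \<open>p\<close>
  they stay on the positive side, where the derivative of order \<open>2 p\<close> is controlled;
  for smaller lags the size of \<open>B\<close> itself suffices, since \<open>m + 1\<close> is then
  bounded.\<close>

lemma nabla_condition_A_bound:
  assumes "L > 0" "condition_A L c \<alpha> K" "\<alpha> < 2 * real p"
  shows "\<exists>C\<ge>0. \<forall>n m. m + p \<le> n \<longrightarrow>
     \<bar>nabla (L / real n) (2 * p) K ((real m - real p) * (L / real n))\<bar>
       \<le> C * (real (m + 1) * (L / real n)) powr (\<alpha> - 2 * real p)"
proof -
  obtain A B C0 D where raw:
    "\<forall>t. K t = A t + B t" "real_analytic_on A UNIV"
    "\<forall>t\<in>{-L..L}. B (- t) = B t" "B 0 = 0" "C0 \<ge> 0"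
    "\<forall>t\<in>{-L..L}. \<bar>B t\<bar> \<le> C0 * \<bar>t\<bar> powr \<alpha>"
    "((\<lambda>t. B t / t powr \<alpha>) \<longlongrightarrow> c) (at_right 0)"
    "\<forall>t\<in>{0<..L}. D 0 t = B t"
    "\<forall>k. \<forall>t\<in>{0<..L}. (D k has_real_derivative D (Suc k) t) (at t within {0<..L})"
    "\<forall>k. \<exists>C\<ge>0. \<forall>t\<in>{0<..L}. \<bar>D k t\<bar> \<le> C * t powr (\<alpha> - real k)"
    by (rule condition_A_decomp[OF assms(1,2)]) (rule that)
  note K = raw(1)[rule_format] and A = raw(2) and C0 = raw(5) and B = raw(6)[rule_format]
    and D0 = raw(8)[rule_format] and D = raw(9)[rule_format] and bD = raw(10)[rule_format]
  have \<alpha>: "\<alpha> > 0" using assms(2) by (simp add: condition_A_def)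
  have p: "p > 0" using \<alpha> assms(3) by (cases p) auto
  define a where "a = 2 * real p - \<alpha>"
  have a: "a > 0" using assms(3) by (simp add: a_def)
  have a': "\<alpha> - 2 * real p = - a" by (simp add: a_def)
  obtain CA where CA: "\<And>h s. h > 0 \<Longrightarrow> - L \<le> s \<Longrightarrow> s + real (2*p) * h \<le> L \<Longrightarrow> \<bar>nabla h (2*p) A s\<bar> \<le> CA"
    using nabla_analytic_bounded[OF A, of L "2*p"] by blast
  obtain C2 where C2: "C2 \<ge> 0" "\<And>t. t \<in> {0<..L} \<Longrightarrow> \<bar>D (2*p) t\<bar> \<le> C2 * t powr (- a)"
    using bD[of "2*p"] by (auto simp: a_def)
  define C1 where "C1 = 4 ^ p * C0 * (2 * real p) powr \<alpha>"
  have C1: "C1 \<ge> 0" using C0 by (simp add: C1_def)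
  \<comment> \<open>Cost of passing from \<open>h\<close>, or from the leftmost node
    \<open>(m - p) h\<close>, to \<open>(m + 1) h\<close>. The ratio
    \<open>(m + 1) / (m - p)\<close> for \<open>m > p\<close> is largest at
    \<open>m = p + 1\<close>, where it equals \<open>p + 2\<close>.\<close>
  define P where "P = (real p + 2) powr a"
  have P: "P \<ge> 0" by (simp add: P_def)
  define C where "C = \<bar>CA\<bar> * L powr a + (C1 + C2) * P"
  have main: "\<bar>nabla h (2 * p) K ((real m - real p) * h)\<bar> \<le> C * (real (m + 1) * h) powr (- a)"
    if mn: "m + p \<le> n" and h_def: "h = L / real n" for n m h
  proof -
    define y where "y = real (m + 1) * h"
    define s where "s = (real m - real p) * h"
    have n: "n > 0" using mn p by auto
    have h: "h > 0" "real n * h = L" using n assms(1) by (auto simp: h_def)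
    have le: "x * h \<le> L" if "x \<le> real n" for x
      using mult_right_mono[OF that, of h] h by simp
    have y: "y > 0" "y \<le> L" using h le[of "real (m+1)"] mn p by (auto simp: y_def)
    have s1: "- L \<le> s"
    proof -
      have "- s = (real p - real m) * h" by (simp add: s_def algebra_simps)
      then show ?thesis using le[of "real p - real m"] mn by simp
    qed
    have s2: "s + real (2*p) * h \<le> L"
      using le[of "real m + real p"] mn by (simp add: s_def algebra_simps)
    have shift: "z powr (- a) \<le> P * y powr (- a)" if "y \<le> (real p + 2) * z" "z > 0" for z
    proof -
      have "z powr (- a) \<le> (y / (real p + 2)) powr (- a)"
        by (rule powr_mono2') (use a y that in \<open>auto simp: field_simps\<close>)
      also have "\<dots> = P * y powr (- a)" using y by (simp add: powr_divide powr_minus_divide P_def)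
      finally show ?thesis .
    qed
    \<comment> \<open>The analytic part is merely bounded; since \<open>y \<le> L\<close>, the
      factor \<open>L powr a * y powr (- a)\<close> is at least 1 and absorbs it.\<close>
    have nA: "\<bar>nabla h (2*p) A s\<bar> \<le> \<bar>CA\<bar> * L powr a * y powr (- a)"
    proof -
      have "y powr a \<le> L powr a" using y a by (intro powr_mono2) auto
      then have "1 \<le> L powr a * y powr (- a)" using y by (simp add: powr_minus_divide)
      then have "\<bar>CA\<bar> * 1 \<le> \<bar>CA\<bar> * (L powr a * y powr (- a))" by (intro mult_left_mono) auto
      then show ?thesis using CA[OF h(1) s1 s2] by (simp add: mult.assoc)
    qed
    \<comment> \<open>For \<open>m \<le> p\<close> every node has modulus at most
      \<open>2 p h\<close> and the binomial coefficients add up to \<open>4 ^ p\<close>, which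
      explains \<open>C1\<close>. For \<open>m > p\<close> the bound on \<open>D (2*p)\<close> is
      decreasing and is taken at the leftmost node \<open>s\<close>.\<close>
    have nB: "\<bar>nabla h (2*p) B s\<bar> \<le> (C1 + C2) * P * y powr (- a)"
    proof (cases "m \<le> p")
      case True
      have "\<bar>\<Sum>k\<le>2*p. (-1) ^ (2*p + k) * real (2*p choose k) * B (s + real k * h)\<bar> \<le>
          (\<Sum>k\<le>2*p. real (2*p choose k) * (C0 * (2 * real p * h) powr \<alpha>))"
      proof (rule order_trans[OF sum_abs], rule sum_mono)
        fix k assume k: "k \<in> {..2*p}"
        have eq: "s + real k * h = (real m - real p + real k) * h" by (simp add: s_def algebra_simps)
        have ab: "\<bar>s + real k * h\<bar> = \<bar>real m - real p + real k\<bar> * h" using h by (simp add: eq abs_mult)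
        have "\<bar>real m - real p + real k\<bar> \<le> real n" using k mn by auto
        then have "\<bar>s + real k * h\<bar> \<le> L" using le ab by simp
        then have "\<bar>B (s + real k * h)\<bar> \<le> C0 * \<bar>s + real k * h\<bar> powr \<alpha>" by (intro B) auto
        also have "\<dots> \<le> C0 * (2 * real p * h) powr \<alpha>"
        proof (intro mult_left_mono powr_mono2 C0)
          have "\<bar>real m - real p + real k\<bar> \<le> 2 * real p" using k True by auto
          then show "\<bar>s + real k * h\<bar> \<le> 2 * real p * h" unfolding ab using h by (intro mult_right_mono) auto
        qed (use \<alpha> in auto)
        finally show "\<bar>(-1) ^ (2*p + k) * real (2*p choose k) * B (s + real k * h)\<bar> \<le>
            real (2*p choose k) * (C0 * (2 * real p * h) powr \<alpha>)"
          by (auto simp: abs_mult intro!: mult_left_mono)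
      qed
      also have "\<dots> = (\<Sum>k\<le>2*p. real (2*p choose k)) * (C0 * (2 * real p * h) powr \<alpha>)"
        by (simp add: sum_distrib_right)
      also have "(\<Sum>k\<le>2*p. real (2*p choose k)) = 4 ^ p"
        using choose_row_sum[of "2*p"] by (simp add: power_mult flip: of_nat_sum)
      also have "4 ^ p * (C0 * (2 * real p * h) powr \<alpha>) = C1 * h powr \<alpha>"
        using h by (simp add: C1_def powr_mult)
      finally have "\<bar>nabla h (2*p) B s\<bar> \<le> C1 * h powr \<alpha> / h ^ (2*p)"
        using h by (simp add: nabla_eq_sum abs_divide divide_right_mono)
      also have "\<dots> = C1 * h powr (- a)"
        using h by (simp add: a_def powr_diff powr_realpow[symmetric])
      also have "\<dots> \<le> C1 * (P * y powr (- a))"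
      proof (intro mult_left_mono shift C1)
        show "y \<le> (real p + 2) * h" unfolding y_def using True h by (intro mult_right_mono) auto
      qed (rule h)
      also have "\<dots> \<le> (C1 + C2) * P * y powr (- a)"
        using C2(1) P by (simp add: algebra_simps)
      finally show ?thesis .
    next
      case False
      have s0: "s > 0" using False h by (simp add: s_def)
      have sub: "{s..s + real (2*p) * h} \<subseteq> {0<..L}" using s0 s2 by auto
      have "\<bar>nabla h (2*p) (D 0) s\<bar> \<le> C2 * s powr (- a)"
      proof (rule abs_nabla_le[of h s s "2*p" "s + real (2*p) * h"])
        fix k t assume "t \<in> {s..s + real (2*p) * h}"
        then show "(D k has_real_derivative D (Suc k) t) (at t within {s..s + real (2*p) * h})"
          using sub by (intro DERIV_subset[OF D sub]) auto
      next
        fix t assume t: "t \<in> {s..s + real (2*p) * h}"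
        then have "\<bar>D (2*p) t\<bar> \<le> C2 * t powr (- a)" using sub by (intro C2(2)) auto
        also have "\<dots> \<le> C2 * s powr (- a)"
          by (intro mult_left_mono C2(1) powr_mono2') (use t s0 a in auto)
        finally show "\<bar>D (2*p) t\<bar> \<le> C2 * s powr (- a)" .
      qed (use h in auto)
      moreover have "nabla h (2*p) (D 0) s = nabla h (2*p) B s"
      proof (rule nabla_cong)
        fix i assume "i \<le> 2*p"
        then have "real i * h \<le> real (2*p) * h" using h by (intro mult_right_mono) auto
        moreover have "real i * h \<ge> 0" using h by simp
        ultimately have "s + real i * h \<in> {0<..L}"
          using s0 s2 unfolding greaterThanAtMost_iff by linarith
        then show "D 0 (s + real i * h) = B (s + real i * h)" by (rule D0)
      qed
      moreover have "s powr (- a) \<le> P * y powr (- a)"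
      proof (rule shift)
        have "real m + 1 \<le> (real p + 2) * (real m - real p)"
        proof -
          have "0 \<le> (real p + 1) * (real m - real p - 1)" using False by (intro mult_nonneg_nonneg) auto
          then show ?thesis by (simp add: algebra_simps)
        qed
        then have "(real m + 1) * h \<le> (real p + 2) * (real m - real p) * h"
          using h by (intro mult_right_mono) auto
        then show "y \<le> (real p + 2) * s" by (simp add: y_def s_def mult.assoc add.commute)
      qed (use s0 in auto)
      ultimately have "\<bar>nabla h (2*p) B s\<bar> \<le> C2 * (P * y powr (- a))"
        using C2(1) mult_left_mono[of "s powr (-a)" "P * y powr (- a)" C2] by linarith
      also have "\<dots> \<le> (C1 + C2) * P * y powr (- a)"
        using C1 P by (simp add: algebra_simps)
      finally show ?thesis .
    qed
    have "nabla h (2*p) K s = nabla h (2*p) A s + nabla h (2*p) B s"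
      using nabla_add[of h "2*p" A B s] by (simp add: K[abs_def])
    with nA nB show ?thesis unfolding y_def[symmetric] s_def[symmetric] C_def
      by (simp add: distrib_right)
  qed
  have "C \<ge> 0" using C1 C2 P by (simp add: C_def)
  then show ?thesis unfolding a' using main by blast
qed

text \<open>All nodes \<open>(k - p) h\<close> shrink to 0, so the limit can be taken term by term
  using only the leading behaviour of \<open>B\<close>. The analytic part contributes a bounded
  difference times \<open>h powr (2 p - \<alpha>)\<close>, which tends to 0.\<close>

lemma nabla_condition_A_limit:
  assumes "L > 0" "condition_A L c \<alpha> K" "\<alpha> < 2 * real p"
  shows "(\<lambda>n. (L / real n) powr (2 * real p - \<alpha>) *
            nabla (L / real n) (2 * p) K (- real p * (L / real n)))
          \<longlonglongrightarrow> c * power_difference p \<alpha>"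
proof -
  obtain A B C0 D where raw:
    "\<forall>t. K t = A t + B t" "real_analytic_on A UNIV"
    "\<forall>t\<in>{-L..L}. B (- t) = B t" "B 0 = 0" "C0 \<ge> 0"
    "\<forall>t\<in>{-L..L}. \<bar>B t\<bar> \<le> C0 * \<bar>t\<bar> powr \<alpha>"
    "((\<lambda>t. B t / t powr \<alpha>) \<longlongrightarrow> c) (at_right 0)"
    "\<forall>t\<in>{0<..L}. D 0 t = B t"
    "\<forall>k. \<forall>t\<in>{0<..L}. (D k has_real_derivative D (Suc k) t) (at t within {0<..L})"
    "\<forall>k. \<exists>C\<ge>0. \<forall>t\<in>{0<..L}. \<bar>D k t\<bar> \<le> C * t powr (\<alpha> - real k)"
    by (rule condition_A_decomp[OF assms(1,2)]) (rule that)
  note K = raw(1)[rule_format] and A = raw(2) and ev = raw(3)[rule_format] and B0 = raw(4)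
    and lim = raw(7)
  have \<alpha>: "\<alpha> > 0" using assms(2) by (simp add: condition_A_def)
  define h where "h n = L / real n" for n
  have h0: "filterlim h (at_right 0) sequentially"
    unfolding h_def using assms(1) by real_asymp
  then have h1: "h \<longlonglongrightarrow> 0" by (simp add: filterlim_at)
  have hpos: "h n > 0" if "n > 0" for n using that assms(1) by (simp add: h_def)
  obtain CA where CA: "\<And>h s. h > 0 \<Longrightarrow> - L \<le> s \<Longrightarrow> s + real (2*p) * h \<le> L \<Longrightarrow> \<bar>nabla h (2*p) A s\<bar> \<le> CA"
    using nabla_analytic_bounded[OF A, of L "2*p"] by blast
  have limA: "(\<lambda>n. h n powr (2 * real p - \<alpha>) * nabla (h n) (2*p) A (- real p * h n)) \<longlonglongrightarrow> 0"
  proof (rule Lim_null_comparison)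
    show "\<forall>\<^sub>F n in sequentially. norm (h n powr (2 * real p - \<alpha>) * nabla (h n) (2*p) A (- real p * h n))
        \<le> h n powr (2 * real p - \<alpha>) * CA"
      using eventually_gt_at_top[of 0] eventually_ge_at_top[of p]
    proof eventually_elim
      case (elim n)
      have "real p * h n \<le> real n * h n" using elim hpos[of n] by (intro mult_right_mono) auto
      then have "real p * h n \<le> L" using elim by (simp add: h_def)
      then have "\<bar>nabla (h n) (2*p) A (- real p * h n)\<bar> \<le> CA"
        using hpos elim by (intro CA) (auto simp: algebra_simps)
      then show ?case by (simp add: abs_mult mult_left_mono)
    qed
    have "(\<lambda>n. h n powr (2 * real p - \<alpha>)) \<longlonglongrightarrow> 0"
      unfolding h_def using assms(1,3) by real_asymp
    then show "(\<lambda>n. h n powr (2 * real p - \<alpha>) * CA) \<longlonglongrightarrow> 0"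
      by (rule tendsto_mult_left_zero)
  qed
  have limB: "(\<lambda>n. B (x * h n) / h n powr \<alpha>) \<longlonglongrightarrow> c * \<bar>x\<bar> powr \<alpha>" for x
  proof (cases "x = 0")
    case True
    then show ?thesis using B0 by simp
  next
    case False
    have "filterlim (\<lambda>n. \<bar>x\<bar> * h n) (at_right 0) sequentially"
      unfolding h_def using assms(1) False by real_asymp
    from filterlim_compose[OF lim this]
    have "(\<lambda>n. B (\<bar>x\<bar> * h n) / (\<bar>x\<bar> * h n) powr \<alpha> * \<bar>x\<bar> powr \<alpha>) \<longlonglongrightarrow> c * \<bar>x\<bar> powr \<alpha>"
      by (intro tendsto_mult tendsto_const)
    \<comment> \<open>Needed for negative \<open>x\<close>: the evenness of \<open>B\<close> is
      available on \<open>{-L..L}\<close> only.\<close>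
    moreover have "\<forall>\<^sub>F n in sequentially. \<bar>x\<bar> * h n < L"
    proof -
      have "(\<lambda>n. \<bar>x\<bar> * h n) \<longlonglongrightarrow> \<bar>x\<bar> * 0" by (intro tendsto_intros h1)
      then show ?thesis using assms(1) by (intro order_tendstoD(2)) auto
    qed
    then have "\<forall>\<^sub>F n in sequentially. B (\<bar>x\<bar> * h n) / (\<bar>x\<bar> * h n) powr \<alpha> * \<bar>x\<bar> powr \<alpha> = B (x * h n) / h n powr \<alpha>"
      using eventually_gt_at_top[of 0]
    proof eventually_elim
      case (elim n)
      then have "B (\<bar>x\<bar> * h n) = B (x * h n)"
        using ev[of "\<bar>x\<bar> * h n"] mult_pos_pos[of "\<bar>x\<bar>" "h n"] hpos[of n] assms(1) False
        by (cases "x > 0") auto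
      then show ?case using hpos[of n] elim False by (simp add: powr_mult)
    qed
    ultimately show ?thesis by (rule Lim_transform_eventually)
  qed
  have m1: "(\<lambda>n. h n powr (2 * real p - \<alpha>) * nabla (h n) (2*p) A (- real p * h n) +
      (\<Sum>k\<le>2*p. (-1) ^ k * real (2*p choose k) * (B ((real k - real p) * h n) / h n powr \<alpha>)))
      \<longlonglongrightarrow> 0 + (\<Sum>k\<le>2*p. (-1) ^ k * real (2*p choose k) * (c * \<bar>real k - real p\<bar> powr \<alpha>))"
    by (intro tendsto_intros limA limB)
  have m2: "0 + (\<Sum>k\<le>2*p. (-1) ^ k * real (2*p choose k) * (c * \<bar>real k - real p\<bar> powr \<alpha>)) =
      c * power_difference p \<alpha>"
    by (simp add: power_difference_def sum_distrib_left algebra_simps)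
  have m3: "\<forall>\<^sub>F n in sequentially. h n powr (2 * real p - \<alpha>) * nabla (h n) (2*p) A (- real p * h n) +
      (\<Sum>k\<le>2*p. (-1) ^ k * real (2*p choose k) * (B ((real k - real p) * h n) / h n powr \<alpha>)) =
      h n powr (2 * real p - \<alpha>) * nabla (h n) (2 * p) K (- real p * h n)"
    using eventually_gt_at_top[of 0]
  proof eventually_elim
    case (elim n)
    have h: "h n > 0" by (rule hpos) fact
    have e: "h n powr (2 * real p - \<alpha>) = h n ^ (2*p) / h n powr \<alpha>"
      using powr_realpow[OF h, of "2*p"] by (simp add: powr_diff)
    have "h n powr (2 * real p - \<alpha>) * nabla (h n) (2*p) B (- real p * h n) =
      (\<Sum>k\<le>2*p. (-1) ^ k * real (2*p choose k) * (B ((real k - real p) * h n) / h n powr \<alpha>))"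
      (is "_ = ?S")
    proof -
      have "?S = (\<Sum>k\<le>2*p. (-1) ^ k * real (2*p choose k) * B ((real k - real p) * h n)) / h n powr \<alpha>"
        by (simp add: sum_divide_distrib)
      moreover have "nabla (h n) (2*p) B (- real p * h n) =
          (\<Sum>k\<le>2*p. (-1) ^ k * real (2*p choose k) * B ((real k - real p) * h n)) / h n ^ (2*p)"
        by (simp add: nabla_eq_sum power_add algebra_simps)
      ultimately show ?thesis unfolding e using h by simp
    qed
    moreover have "nabla (h n) (2*p) K (- real p * h n) =
        nabla (h n) (2*p) A (- real p * h n) + nabla (h n) (2*p) B (- real p * h n)"
      using nabla_add[of "h n" "2*p" A B] by (simp add: K[abs_def])
    ultimately show ?case by (simp add: distrib_left)
  qed
  show ?thesis
    using Lim_transform_eventually[OF m1 m3] unfolding m2 h_def .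
qed

section \<open>Sums of powers over lags\<close>

text \<open>With truncated subtraction \<open>j - k + (k - j)\<close> is the distance of
  \<open>j\<close> and \<open>k\<close>; within a row each lag occurs at most twice.\<close>

lemma sum_abs_diff_le:
  fixes g :: "nat \<Rightarrow> real"
  assumes "\<And>m. g m \<ge> 0"
  shows "(\<Sum>j<N. \<Sum>k<N. g (j - k + (k - j))) \<le> 2 * real N * (\<Sum>m<N. g m)"
proof -
  have "(\<Sum>k<N. g (j - k + (k - j))) \<le> 2 * (\<Sum>m<N. g m)" if j: "j < N" for j
  proof -
    have "{..<j} \<union> {j..<N} = {..<N}" using j by auto
    then have "(\<Sum>k<N. g (j - k + (k - j))) =
        (\<Sum>k<j. g (j - k + (k - j))) + (\<Sum>k\<in>{j..<N}. g (j - k + (k - j)))"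
      using sum.union_disjoint[of "{..<j}" "{j..<N}" "\<lambda>k. g (j - k + (k - j))"] by force
    also have "(\<Sum>k<j. g (j - k + (k - j))) = sum g ((\<lambda>k. j - k) ` {..<j})"
      by (subst sum.reindex) (auto simp: inj_on_def intro: sum.cong)
    also have "(\<Sum>k\<in>{j..<N}. g (j - k + (k - j))) = sum g ((\<lambda>k. k - j) ` {j..<N})"
      by (subst sum.reindex) (auto simp: inj_on_def intro: sum.cong)
    also have "sum g ((\<lambda>k. j - k) ` {..<j}) \<le> sum g {..<N}"
      by (rule sum_mono2) (use j assms in auto)
    also have "sum g ((\<lambda>k. k - j) ` {j..<N}) \<le> sum g {..<N}"
      by (rule sum_mono2) (use assms in auto)
    finally show ?thesis by simp
  qed
  then have "(\<Sum>j<N. \<Sum>k<N. g (j - k + (k - j))) \<le> (\<Sum>j<N. 2 * (\<Sum>m<N. g m))"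
    by (intro sum_mono) auto
  then show ?thesis by simp
qed

text \<open>Comparison with the integral of \<open>x powr (- e)\<close>, carried out as a
  telescoping sum with the mean value theorem on each unit interval. The first interval is separate
  because its end point 0 is outside the range of the derivative rule.\<close>

lemma sum_powr_le:
  fixes e :: real
  assumes "0 < e" "e < 1"
  shows "(\<Sum>m<N. real (m + 1) powr (- e)) \<le> real N powr (1 - e) / (1 - e)"
proof (induction N)
  case (Suc N)
  have "real (N + 1) powr (- e) \<le> (real (N + 1) powr (1 - e) - real N powr (1 - e)) / (1 - e)"
  proof (cases "N = 0")
    case True
    then show ?thesis using assms by simp
  next
    case False
    have "\<exists>z. real N < z \<and> z < real (N + 1) \<and>
        real (N + 1) powr (1 - e) - real N powr (1 - e) =
        (real (N + 1) - real N) * ((1 - e) * z powr (1 - e - 1))"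
    proof (rule MVT2)
      fix x assume "real N \<le> x"
      then have "x > 0" using False by simp
      then show "((\<lambda>x. x powr (1 - e)) has_real_derivative (1 - e) * x powr (1 - e - 1)) (at x)"
        by (rule has_real_derivative_powr)
    qed auto
    then obtain z where z: "real N < z" "z < real (N + 1)"
      "real (N + 1) powr (1 - e) - real N powr (1 - e) = (1 - e) * z powr (- e)"
      by auto
    have "real (N + 1) powr (- e) \<le> z powr (- e)"
      by (rule powr_mono2') (use z assms in auto)
    then show ?thesis using assms z(3) by simp
  qed
  then show ?case using Suc.IH by (simp add: diff_divide_distrib)
qed simp

text \<open>For \<open>d < 1\<close> there is an \<open>e\<close> with \<open>d < e < 1\<close> and \<open>e \<le> 2 a + d\<close>; since \<open>(m + 1) h \<ge> h\<close>,
  the exponent \<open>2 a + d\<close> can be lowered to \<open>e\<close>, for which the averages are bounded.\<close>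

lemma average_powr_tendsto_0:
  fixes a d L :: real
  assumes "L > 0" "a > 0" "0 \<le> d" "d < 1"
  shows "(\<lambda>n. (L / real n) powr (2 * a) *
      (\<Sum>m<n + 1 - p. (real (m + 1) * (L / real n)) powr (- (2 * a + d))) / real (n + 1 - p)) \<longlonglongrightarrow> 0"
proof -
  define e where "e = min (2 * a + d) ((1 + d) / 2)"
  have e: "d < e" "e < 1" "e \<le> 2 * a + d" "0 < e" using assms by (auto simp: e_def min_def)
  show ?thesis
  proof (rule Lim_null_comparison)
    show "\<forall>\<^sub>F n in sequentially. norm ((L / real n) powr (2 * a) *
        (\<Sum>m<n + 1 - p. (real (m + 1) * (L / real n)) powr (- (2 * a + d))) / real (n + 1 - p)) \<le>
        (L / real n) powr (- d) * (real n / 2) powr (- e) / (1 - e)"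
      using eventually_gt_at_top[of "2 * p"]
    proof eventually_elim
      case (elim n)
      define N where "N = n + 1 - p"
      define h where "h = L / real n"
      have h: "h > 0" using elim assms by (simp add: h_def)
      have N: "real N \<ge> real n / 2" "real N > 0" using elim by (auto simp: N_def)
      have "(\<Sum>m<N. (real (m + 1) * h) powr (- (2 * a + d))) \<le>
          (\<Sum>m<N. h powr (- (2 * a + d)) * real (m + 1) powr (- e))"
      proof (rule sum_mono)
        fix m
        have "(real (m + 1) * h) powr (- (2 * a + d)) = h powr (- (2 * a + d)) * real (m + 1) powr (- (2 * a + d))"
          using h by (simp add: powr_mult)
        also have "\<dots> \<le> h powr (- (2 * a + d)) * real (m + 1) powr (- e)"
          by (intro mult_left_mono powr_mono) (use e in auto)
        finally show "(real (m + 1) * h) powr (- (2 * a + d)) \<le> h powr (- (2 * a + d)) * real (m + 1) powr (- e)" .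
      qed
      also have "\<dots> \<le> h powr (- (2 * a + d)) * (real N powr (1 - e) / (1 - e))"
        unfolding sum_distrib_left[symmetric] by (intro mult_left_mono sum_powr_le e) auto
      finally have "h powr (2 * a) * (\<Sum>m<N. (real (m + 1) * h) powr (- (2 * a + d))) / real N \<le>
          h powr (2 * a) * (h powr (- (2 * a + d)) * (real N powr (1 - e) / (1 - e))) / real N"
        by (intro divide_right_mono mult_left_mono) auto
      also have "\<dots> = h powr (- d) * real N powr (- e) / (1 - e)"
      proof -
        have "h powr (2 * a) * h powr (- (2 * a + d)) = h powr (- d)"
          by (simp add: powr_add[symmetric])
        moreover have "real N powr (1 - e) / real N = real N powr (- e)"
          using N by (simp add: powr_diff powr_minus_divide)
        moreover have "h powr (2 * a) * (h powr (- (2 * a + d)) * (real N powr (1 - e) / (1 - e))) / real N =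
            h powr (2 * a) * h powr (- (2 * a + d)) * (real N powr (1 - e) / real N) / (1 - e)"
          by (simp only: times_divide_eq_left times_divide_eq_right divide_divide_eq_left mult.assoc mult.commute[of "real N"])
        ultimately show ?thesis by (simp only:)
      qed
      also have "\<dots> \<le> h powr (- d) * (real n / 2) powr (- e) / (1 - e)"
        by (intro divide_right_mono mult_left_mono powr_mono2') (use e N elim in auto)
      finally have "h powr (2 * a) * (\<Sum>m<N. (real (m + 1) * h) powr (- (2 * a + d))) / real N \<le>
          h powr (- d) * (real n / 2) powr (- e) / (1 - e)" .
      moreover have "h powr (2 * a) * (\<Sum>m<N. (real (m + 1) * h) powr (- (2 * a + d))) / real N \<ge> 0"
        by (intro divide_nonneg_nonneg mult_nonneg_nonneg sum_nonneg) auto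
      ultimately show ?case unfolding N_def h_def real_norm_def by (simp only: abs_of_nonneg)
    qed
    have "(\<lambda>n. L powr (- d) * 2 powr e / (1 - e) * real n powr (d - e)) \<longlonglongrightarrow> 0"
      using e by (intro tendsto_mult_right_zero) real_asymp
    then show "(\<lambda>n. (L / real n) powr (- d) * (real n / 2) powr (- e) / (1 - e)) \<longlonglongrightarrow> 0"
    proof (rule Lim_transform_eventually)
      show "\<forall>\<^sub>F n in sequentially. L powr (- d) * 2 powr e / (1 - e) * real n powr (d - e) =
          (L / real n) powr (- d) * (real n / 2) powr (- e) / (1 - e)"
        using eventually_gt_at_top[of 0]
        by eventually_elim (use assms in \<open>simp add: powr_divide powr_minus_divide powr_diff field_simps\<close>)
    qed
  qed
qed

section \<open>Gaussian spaces\<close>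

text \<open>Isolates what the argument needs from Gaussianity: a linear space on which the fourth
  moment is three times the squared second moment. Polarization over the space then yields Isserlis'
  formula without joint densities, so degenerate variables need no separate treatment.\<close>

locale gaussian_space = prob_space M for M :: "'a measure" +
  fixes G :: "('a \<Rightarrow> real) set"
  assumes meas: "X \<in> G \<Longrightarrow> X \<in> borel_measurable M"
    and add: "X \<in> G \<Longrightarrow> Y \<in> G \<Longrightarrow> (\<lambda>\<omega>. X \<omega> + Y \<omega>) \<in> G"
    and scale: "X \<in> G \<Longrightarrow> (\<lambda>\<omega>. r * X \<omega>) \<in> G"
    and integrable_power4: "X \<in> G \<Longrightarrow> integrable M (\<lambda>\<omega>. X \<omega> ^ 4)"
    and kurtosis: "X \<in> G \<Longrightarrow> expectation (\<lambda>\<omega>. X \<omega> ^ 4) = 3 * (expectation (\<lambda>\<omega>. X \<omega> * X \<omega>))\<^sup>2"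
begin

abbreviation ip :: "('a \<Rightarrow> real) \<Rightarrow> ('a \<Rightarrow> real) \<Rightarrow> real" where
  "ip X Y \<equiv> expectation (\<lambda>\<omega>. X \<omega> * Y \<omega>)"

lemma diff: "X \<in> G \<Longrightarrow> Y \<in> G \<Longrightarrow> (\<lambda>\<omega>. X \<omega> - Y \<omega>) \<in> G"
  using add[of X "\<lambda>\<omega>. (-1) * Y \<omega>"] scale[of Y "-1"] by simp

lemma integrable_square_product:
  assumes "X \<in> G" "Y \<in> G"
  shows "integrable M (\<lambda>\<omega>. (X \<omega>)\<^sup>2 * (Y \<omega>)\<^sup>2)"
proof (rule Bochner_Integration.integrable_bound)
  show "integrable M (\<lambda>\<omega>. X \<omega> ^ 4 + Y \<omega> ^ 4)"
    using assms by (intro Bochner_Integration.integrable_add integrable_power4)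
  have "(x\<^sup>2 * y\<^sup>2 :: real) \<le> x ^ 4 + y ^ 4" for x y
  proof -
    have "2 * x\<^sup>2 * y\<^sup>2 \<le> x ^ 4 + y ^ 4"
      using sum_squares_bound[of "x\<^sup>2" "y\<^sup>2"] by simp
    moreover have "0 \<le> x\<^sup>2 * y\<^sup>2" by simp
    ultimately show ?thesis by linarith
  qed
  then show "AE \<omega> in M. norm ((X \<omega>)\<^sup>2 * (Y \<omega>)\<^sup>2) \<le> norm (X \<omega> ^ 4 + Y \<omega> ^ 4)" by simp
qed (use meas[OF assms(1)] meas[OF assms(2)] in measurable)

lemma integrable_product4:
  assumes "X \<in> G" "Y \<in> G" "U \<in> G" "V \<in> G"
  shows "integrable M (\<lambda>\<omega>. X \<omega> * Y \<omega> * (U \<omega> * V \<omega>))"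
proof (rule Bochner_Integration.integrable_bound)
  show "integrable M (\<lambda>\<omega>. (X \<omega>)\<^sup>2 * (Y \<omega>)\<^sup>2 + (U \<omega>)\<^sup>2 * (V \<omega>)\<^sup>2)"
    using assms by (intro Bochner_Integration.integrable_add integrable_square_product)
  have "\<bar>x * y :: real\<bar> \<le> x\<^sup>2 + y\<^sup>2" for x y
    using sum_squares_bound[of "\<bar>x\<bar>" "\<bar>y\<bar>"] abs_mult[of x y] by simp
  then have "\<bar>X \<omega> * Y \<omega> * (U \<omega> * V \<omega>)\<bar> \<le> (X \<omega> * Y \<omega>)\<^sup>2 + (U \<omega> * V \<omega>)\<^sup>2" for \<omega> by blast
  then show "AE \<omega> in M. norm (X \<omega> * Y \<omega> * (U \<omega> * V \<omega>)) \<le>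
      norm ((X \<omega>)\<^sup>2 * (Y \<omega>)\<^sup>2 + (U \<omega>)\<^sup>2 * (V \<omega>)\<^sup>2)"
    by (simp add: power_mult_distrib)
qed (use meas[OF assms(1)] meas[OF assms(2)] meas[OF assms(3)] meas[OF assms(4)] in measurable)

lemma integrable_product:
  assumes "X \<in> G" "Y \<in> G"
  shows "integrable M (\<lambda>\<omega>. X \<omega> * Y \<omega>)"
proof (rule Bochner_Integration.integrable_bound)
  show "integrable M (\<lambda>\<omega>. 1 + (X \<omega>)\<^sup>2 * (Y \<omega>)\<^sup>2)"
    using assms by (intro Bochner_Integration.integrable_add integrable_square_product) auto
  have "\<bar>x :: real\<bar> \<le> 1 + x\<^sup>2" for x
    using sum_squares_bound[of 1 "\<bar>x\<bar>"] by simp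
  then have "\<bar>X \<omega> * Y \<omega>\<bar> \<le> 1 + (X \<omega> * Y \<omega>)\<^sup>2" for \<omega> by blast
  then show "AE \<omega> in M. norm (X \<omega> * Y \<omega>) \<le> norm (1 + (X \<omega>)\<^sup>2 * (Y \<omega>)\<^sup>2)"
    by (simp add: power_mult_distrib)
qed (use meas[OF assms(1)] meas[OF assms(2)] in measurable)

lemma ip_commute: "ip X Y = ip Y X"
  by (simp add: mult.commute)

lemma ip_add_left: "X \<in> G \<Longrightarrow> Y \<in> G \<Longrightarrow> U \<in> G \<Longrightarrow> ip (\<lambda>\<omega>. X \<omega> + Y \<omega>) U = ip X U + ip Y U"
  by (simp add: distrib_right integrable_product)

lemma ip_diff_left: "X \<in> G \<Longrightarrow> Y \<in> G \<Longrightarrow> U \<in> G \<Longrightarrow> ip (\<lambda>\<omega>. X \<omega> - Y \<omega>) U = ip X U - ip Y U"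
  by (simp add: left_diff_distrib integrable_product)

lemma ip_add_right: "X \<in> G \<Longrightarrow> Y \<in> G \<Longrightarrow> U \<in> G \<Longrightarrow> ip U (\<lambda>\<omega>. X \<omega> + Y \<omega>) = ip U X + ip U Y"
  by (simp add: distrib_left integrable_product)

lemma ip_diff_right: "X \<in> G \<Longrightarrow> Y \<in> G \<Longrightarrow> U \<in> G \<Longrightarrow> ip U (\<lambda>\<omega>. X \<omega> - Y \<omega>) = ip U X - ip U Y"
  by (simp add: right_diff_distrib integrable_product)

lemma ip_scale_left: "ip (\<lambda>\<omega>. r * X \<omega>) U = r * ip X U"
  by (simp add: mult.assoc)

lemma ip_scale_right: "ip U (\<lambda>\<omega>. r * X \<omega>) = r * ip U X"
  by (simp add: mult.left_commute)

lemmas ip_simps = ip_add_left ip_add_right ip_diff_left ip_diff_right ip_scale_left ip_scale_right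

text \<open>Polarization of the quartic identity \<open>kurtosis\<close>, applied to
  \<open>X\<close>, \<open>Y\<close>, their sum and their difference.\<close>

lemma expectation_square_product:
  assumes "X \<in> G" "Y \<in> G"
  shows "expectation (\<lambda>\<omega>. (X \<omega>)\<^sup>2 * (Y \<omega>)\<^sup>2) = ip X X * ip Y Y + 2 * (ip X Y)\<^sup>2"
proof -
  note G = assms add[OF assms] diff[OF assms]
  have "12 * (x\<^sup>2 * y\<^sup>2) = (x + y) ^ 4 + (x - y) ^ 4 - 2 * x ^ 4 - 2 * (y ^ 4 :: real)" for x y
    by algebra
  then have "12 * expectation (\<lambda>\<omega>. (X \<omega>)\<^sup>2 * (Y \<omega>)\<^sup>2) =
      expectation (\<lambda>\<omega>. (X \<omega> + Y \<omega>) ^ 4 + (X \<omega> - Y \<omega>) ^ 4 - 2 * X \<omega> ^ 4 - 2 * Y \<omega> ^ 4)"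
    by (simp flip: integral_mult_right_zero)
  also have "\<dots> = expectation (\<lambda>\<omega>. (X \<omega> + Y \<omega>) ^ 4) + expectation (\<lambda>\<omega>. (X \<omega> - Y \<omega>) ^ 4) -
      2 * expectation (\<lambda>\<omega>. X \<omega> ^ 4) - 2 * expectation (\<lambda>\<omega>. Y \<omega> ^ 4)"
    using integrable_power4[OF G(1)] integrable_power4[OF G(2)] integrable_power4[OF G(3)]
      integrable_power4[OF G(4)] by simp
  also have "\<dots> = 12 * (ip X X * ip Y Y + 2 * (ip X Y)\<^sup>2)"
    unfolding kurtosis[OF G(1)] kurtosis[OF G(2)] kurtosis[OF G(3)] kurtosis[OF G(4)]
    by (simp add: ip_simps G ip_commute[of Y X]) algebra
  finally show ?thesis by simp
qed

text \<open>A second polarization, based on \<open>4 x u = (x + u)^2 - (x - u)^2\<close> and the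
  same for \<open>y\<close> and \<open>v\<close>.\<close>

lemma isserlis:
  assumes "X \<in> G" "Y \<in> G" "U \<in> G" "V \<in> G"
  shows "expectation (\<lambda>\<omega>. X \<omega> * Y \<omega> * (U \<omega> * V \<omega>)) =
    ip X Y * ip U V + ip X U * ip Y V + ip X V * ip Y U"
proof -
  note G = assms add[OF assms(1,3)] add[OF assms(2,4)] diff[OF assms(1,3)] diff[OF assms(2,4)]
  have "16 * (x * y * (u * v)) = (x + u)\<^sup>2 * (y + v)\<^sup>2 - (x + u)\<^sup>2 * (y - v)\<^sup>2 -
      (x - u)\<^sup>2 * (y + v)\<^sup>2 + (x - u)\<^sup>2 * (y - v :: real)\<^sup>2" for x y u v
    by algebra
  then have "16 * expectation (\<lambda>\<omega>. X \<omega> * Y \<omega> * (U \<omega> * V \<omega>)) =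
      expectation (\<lambda>\<omega>. (X \<omega> + U \<omega>)\<^sup>2 * (Y \<omega> + V \<omega>)\<^sup>2 - (X \<omega> + U \<omega>)\<^sup>2 * (Y \<omega> - V \<omega>)\<^sup>2 -
      (X \<omega> - U \<omega>)\<^sup>2 * (Y \<omega> + V \<omega>)\<^sup>2 + (X \<omega> - U \<omega>)\<^sup>2 * (Y \<omega> - V \<omega>)\<^sup>2)"
    by (simp flip: integral_mult_right_zero)
  also have "\<dots> = expectation (\<lambda>\<omega>. (X \<omega> + U \<omega>)\<^sup>2 * (Y \<omega> + V \<omega>)\<^sup>2) -
      expectation (\<lambda>\<omega>. (X \<omega> + U \<omega>)\<^sup>2 * (Y \<omega> - V \<omega>)\<^sup>2) -
      expectation (\<lambda>\<omega>. (X \<omega> - U \<omega>)\<^sup>2 * (Y \<omega> + V \<omega>)\<^sup>2) +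
      expectation (\<lambda>\<omega>. (X \<omega> - U \<omega>)\<^sup>2 * (Y \<omega> - V \<omega>)\<^sup>2)"
    using integrable_square_product[OF G(5,6)] integrable_square_product[OF G(5,8)]
      integrable_square_product[OF G(7,6)] integrable_square_product[OF G(7,8)] by simp
  also have "\<dots> = 16 * (ip X Y * ip U V + ip X U * ip Y V + ip X V * ip Y U)"
    unfolding expectation_square_product[OF G(5,6)] expectation_square_product[OF G(5,8)]
      expectation_square_product[OF G(7,6)] expectation_square_product[OF G(7,8)]
    by (simp add: ip_simps G ip_commute[of U X] ip_commute[of V X] ip_commute[of Y X]
         ip_commute[of V U] ip_commute[of U Y] ip_commute[of V Y]) algebra
  finally show ?thesis by simp
qed

text \<open>The first pairing in Isserlis' formula adds up to the squared mean; the other two form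
  the variance. The numerator is covered directly and the denominator by
  \<open>W = X\<close>.\<close>

lemma expectation_square_sum_products:
  assumes "\<And>j. j < N \<Longrightarrow> X j \<in> G" "\<And>j. j < N \<Longrightarrow> W j \<in> G"
  shows "integrable M (\<lambda>\<omega>. (\<Sum>j<N. X j \<omega> * W j \<omega>)\<^sup>2)"
    and "expectation (\<lambda>\<omega>. (\<Sum>j<N. X j \<omega> * W j \<omega>)\<^sup>2) =
      (\<Sum>j<N. ip (X j) (W j))\<^sup>2 +
      (\<Sum>j<N. \<Sum>k<N. ip (X j) (X k) * ip (W j) (W k) + ip (X j) (W k) * ip (W j) (X k))"
proof -
  have e: "(\<lambda>\<omega>. (\<Sum>j<N. X j \<omega> * W j \<omega>)\<^sup>2) =
      (\<lambda>\<omega>. \<Sum>j<N. \<Sum>k<N. X j \<omega> * W j \<omega> * (X k \<omega> * W k \<omega>))"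
    by (simp add: power2_eq_square sum_product)
  have int: "integrable M (\<lambda>\<omega>. X j \<omega> * W j \<omega> * (X k \<omega> * W k \<omega>))" if "j < N" "k < N" for j k
    using that by (intro integrable_product4 assms)
  show "integrable M (\<lambda>\<omega>. (\<Sum>j<N. X j \<omega> * W j \<omega>)\<^sup>2)"
    unfolding e by (intro Bochner_Integration.integrable_sum int) auto
  have "expectation (\<lambda>\<omega>. (\<Sum>j<N. X j \<omega> * W j \<omega>)\<^sup>2) =
      (\<Sum>j<N. expectation (\<lambda>\<omega>. \<Sum>k<N. X j \<omega> * W j \<omega> * (X k \<omega> * W k \<omega>)))"
    unfolding e by (intro Bochner_Integration.integral_sum Bochner_Integration.integrable_sum int) auto
  also have "\<dots> = (\<Sum>j<N. \<Sum>k<N. expectation (\<lambda>\<omega>. X j \<omega> * W j \<omega> * (X k \<omega> * W k \<omega>)))"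
    by (intro sum.cong Bochner_Integration.integral_sum int) auto
  also have "\<dots> = (\<Sum>j<N. \<Sum>k<N. ip (X j) (W j) * ip (X k) (W k) +
      (ip (X j) (X k) * ip (W j) (W k) + ip (X j) (W k) * ip (W j) (X k)))"
    by (intro sum.cong refl) (subst isserlis; auto intro: assms)
  finally show "expectation (\<lambda>\<omega>. (\<Sum>j<N. X j \<omega> * W j \<omega>)\<^sup>2) =
      (\<Sum>j<N. ip (X j) (W j))\<^sup>2 +
      (\<Sum>j<N. \<Sum>k<N. ip (X j) (X k) * ip (W j) (W k) + ip (X j) (W k) * ip (W j) (X k))"
    by (simp add: sum.distrib power2_eq_square sum_product)
qed

lemma prob_gt_le_second_moment:
  assumes "Y \<in> borel_measurable M" "integrable M (\<lambda>\<omega>. (Y \<omega>)\<^sup>2)" "t > 0"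
  shows "prob {\<omega>\<in>space M. \<bar>Y \<omega>\<bar> \<ge> t} \<le> expectation (\<lambda>\<omega>. (Y \<omega>)\<^sup>2) / t\<^sup>2"
  using second_moment_method[OF assms] .

text \<open>Chebyshev's inequality for denominator and numerator: if the former is above half its
  mean and the latter below \<open>\<epsilon>\<close> times that half, the ratio is small. The term
  \<open>r / v\<close> is the bias of the ratio, and \<open>B\<close> dominates both variances.
  Positivity of the denominator belongs to the event because division by 0 gives 0 and would conceal
  a failure.\<close>

lemma prob_ratio_le:
  assumes X: "\<And>j. j < N \<Longrightarrow> X j \<in> G" and W: "\<And>j. j < N \<Longrightarrow> W j \<in> G"
    and v: "\<And>j. j < N \<Longrightarrow> ip (X j) (X j) = v" and r: "\<And>j. j < N \<Longrightarrow> ip (X j) (W j) = r"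
    and "N > 0" "v > 0" "\<epsilon> > 0"
    and B: "(\<Sum>j<N. \<Sum>k<N. \<bar>ip (X j) (X k)\<bar> * \<bar>ip (W j) (W k)\<bar> + \<bar>ip (X j) (W k)\<bar> * \<bar>ip (W j) (X k)\<bar>) \<le> B"
    and B': "(\<Sum>j<N. \<Sum>k<N. 2 * (ip (X j) (X k))\<^sup>2) \<le> B"
  shows "prob {\<omega>\<in>space M. \<not> ((\<Sum>j<N. (X j \<omega>)\<^sup>2) > 0 \<and>
        \<bar>(\<Sum>j<N. X j \<omega> * W j \<omega>) / (\<Sum>j<N. (X j \<omega>)\<^sup>2)\<bar> \<le> \<epsilon>)}
    \<le> 4 * B / (real N * v)\<^sup>2 + 4 / \<epsilon>\<^sup>2 * ((r / v)\<^sup>2 + B / (real N * v)\<^sup>2)"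
proof -
  define S where "S \<omega> = (\<Sum>j<N. X j \<omega> * X j \<omega>)" for \<omega>
  define T where "T \<omega> = (\<Sum>j<N. X j \<omega> * W j \<omega>)" for \<omega>
  \<comment> \<open>Here \<open>n\<close> is the mean of the denominator \<open>S\<close>, not a
    number of points.\<close>
  define n where "n = real N * v"
  have n: "n > 0" using assms by (simp add: n_def)
  have mX: "X j \<in> borel_measurable M" "W j \<in> borel_measurable M" if "j < N" for j
    using that X W meas by auto
  have mS [measurable]: "S \<in> borel_measurable M" "T \<in> borel_measurable M"
    unfolding S_def T_def by (intro borel_measurable_sum borel_measurable_times mX; simp)+
  have iS2: "integrable M (\<lambda>\<omega>. (S \<omega>)\<^sup>2)" and eS2: "expectation (\<lambda>\<omega>. (S \<omega>)\<^sup>2) = n\<^sup>2 +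
      (\<Sum>j<N. \<Sum>k<N. 2 * (ip (X j) (X k))\<^sup>2)"
    using expectation_square_sum_products[where N = N and X = X and W = X, OF X X] v
    by (auto simp: S_def n_def power2_eq_square)
  have iT2: "integrable M (\<lambda>\<omega>. (T \<omega>)\<^sup>2)" and eT2: "expectation (\<lambda>\<omega>. (T \<omega>)\<^sup>2) = (real N * r)\<^sup>2 +
      (\<Sum>j<N. \<Sum>k<N. ip (X j) (X k) * ip (W j) (W k) + ip (X j) (W k) * ip (W j) (X k))"
    using expectation_square_sum_products[where N = N and X = X and W = W, OF X W] r by (auto simp: T_def)
  have iS: "integrable M S" and eS: "expectation S = n"
  proof -
    have "integrable M (\<lambda>\<omega>. X j \<omega> * X j \<omega>)" if "j < N" for j using that by (intro integrable_product X)
    then show "integrable M S" "expectation S = n"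
      unfolding S_def[abs_def] n_def using v
      by (auto intro!: Bochner_Integration.integrable_sum simp: Bochner_Integration.integral_sum)
  qed
  have dS: "(\<lambda>\<omega>. (S \<omega> - n)\<^sup>2) = (\<lambda>\<omega>. (S \<omega>)\<^sup>2 - 2 * n * S \<omega> + n\<^sup>2)"
    by (auto simp: power2_diff)
  have iD: "integrable M (\<lambda>\<omega>. (S \<omega> - n)\<^sup>2)" unfolding dS using iS iS2 by simp
  have "expectation (\<lambda>\<omega>. (S \<omega> - n)\<^sup>2) = expectation (\<lambda>\<omega>. (S \<omega>)\<^sup>2) - 2 * n * n + n\<^sup>2"
    unfolding dS using iS iS2 eS by (simp add: prob_space)
  then have eD: "expectation (\<lambda>\<omega>. (S \<omega> - n)\<^sup>2) \<le> B"
    using B' eS2 by (simp add: power2_eq_square)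
  have eT: "expectation (\<lambda>\<omega>. (T \<omega>)\<^sup>2) \<le> (real N * r)\<^sup>2 + B"
  proof -
    have "(\<Sum>j<N. \<Sum>k<N. ip (X j) (X k) * ip (W j) (W k) + ip (X j) (W k) * ip (W j) (X k)) \<le>
      (\<Sum>j<N. \<Sum>k<N. \<bar>ip (X j) (X k)\<bar> * \<bar>ip (W j) (W k)\<bar> + \<bar>ip (X j) (W k)\<bar> * \<bar>ip (W j) (X k)\<bar>)"
      by (intro sum_mono add_mono) (simp_all flip: abs_mult)
    then show ?thesis using eT2 B by linarith
  qed
  have pS: "prob {\<omega>\<in>space M. \<bar>S \<omega> - n\<bar> \<ge> n / 2} \<le> 4 * B / n\<^sup>2"
  proof -
    have "prob {\<omega>\<in>space M. \<bar>S \<omega> - n\<bar> \<ge> n / 2} \<le> expectation (\<lambda>\<omega>. (S \<omega> - n)\<^sup>2) / (n / 2)\<^sup>2"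
      by (rule prob_gt_le_second_moment) (use n iD in auto)
    also have "\<dots> \<le> B / (n / 2)\<^sup>2" by (intro divide_right_mono eD) simp
    also have "B / (n / 2)\<^sup>2 = 4 * B / n\<^sup>2" by (simp add: power_divide)
    finally show ?thesis .
  qed
  have pT: "prob {\<omega>\<in>space M. \<bar>T \<omega>\<bar> \<ge> \<epsilon> * n / 2} \<le> 4 / \<epsilon>\<^sup>2 * ((r / v)\<^sup>2 + B / n\<^sup>2)"
  proof -
    have "prob {\<omega>\<in>space M. \<bar>T \<omega>\<bar> \<ge> \<epsilon> * n / 2} \<le> expectation (\<lambda>\<omega>. (T \<omega>)\<^sup>2) / (\<epsilon> * n / 2)\<^sup>2"
      by (rule prob_gt_le_second_moment) (use n iT2 assms in auto)
    also have "\<dots> \<le> ((real N * r)\<^sup>2 + B) / (\<epsilon> * n / 2)\<^sup>2" by (intro divide_right_mono eT) simp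
    also have "\<dots> = 4 / \<epsilon>\<^sup>2 * ((real N * r / n)\<^sup>2 + B / n\<^sup>2)"
      using n assms by (simp add: field_simps)
    also have "real N * r / n = r / v" using assms by (simp add: n_def)
    finally show ?thesis .
  qed
  have "{\<omega>\<in>space M. \<not> (S \<omega> > 0 \<and> \<bar>T \<omega> / S \<omega>\<bar> \<le> \<epsilon>)} \<subseteq>
      {\<omega>\<in>space M. \<bar>S \<omega> - n\<bar> \<ge> n / 2} \<union> {\<omega>\<in>space M. \<bar>T \<omega>\<bar> \<ge> \<epsilon> * n / 2}"
  proof (rule subsetI, rule ccontr)
    fix \<omega> assume a: "\<omega> \<in> {\<omega>\<in>space M. \<not> (S \<omega> > 0 \<and> \<bar>T \<omega> / S \<omega>\<bar> \<le> \<epsilon>)}"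
      and "\<omega> \<notin> {\<omega>\<in>space M. \<bar>S \<omega> - n\<bar> \<ge> n / 2} \<union> {\<omega>\<in>space M. \<bar>T \<omega>\<bar> \<ge> \<epsilon> * n / 2}"
    then have b: "\<bar>S \<omega> - n\<bar> < n / 2" "\<bar>T \<omega>\<bar> < \<epsilon> * n / 2" by auto
    then have "S \<omega> > n / 2" by (auto simp: abs_if split: if_splits)
    then have "\<epsilon> * S \<omega> > \<epsilon> * (n / 2)" "S \<omega> > 0" using assms n by auto
    moreover have "\<bar>T \<omega> / S \<omega>\<bar> \<le> \<epsilon>"
      using b calculation by (simp add: abs_divide pos_divide_le_eq)
    ultimately show False using a by auto
  qed
  then have "prob {\<omega>\<in>space M. \<not> (S \<omega> > 0 \<and> \<bar>T \<omega> / S \<omega>\<bar> \<le> \<epsilon>)} \<le>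
      prob ({\<omega>\<in>space M. \<bar>S \<omega> - n\<bar> \<ge> n / 2} \<union> {\<omega>\<in>space M. \<bar>T \<omega>\<bar> \<ge> \<epsilon> * n / 2})"
    by (intro finite_measure_mono) auto
  also have "\<dots> \<le> prob {\<omega>\<in>space M. \<bar>S \<omega> - n\<bar> \<ge> n / 2} + prob {\<omega>\<in>space M. \<bar>T \<omega>\<bar> \<ge> \<epsilon> * n / 2}"
    by (intro measure_Un_le) measurable
  finally show ?thesis
    using pS pT by (simp add: S_def T_def n_def power2_eq_square)
qed

lemma nabla_mem:
  assumes "\<And>s. z s \<in> G"
  shows "(\<lambda>\<omega>. nabla h q (\<lambda>s. z s \<omega>) s) \<in> G"
proof (induction q arbitrary: s)
  case (Suc q)
  have "(\<lambda>\<omega>. (1 / h) * (nabla h q (\<lambda>s. z s \<omega>) (s + h) - nabla h q (\<lambda>s. z s \<omega>) s)) \<in> G"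
    by (intro scale diff Suc.IH)
  then show ?case by (simp add: nabla_Suc' nabla1_def)
qed (use assms in simp)

text \<open>Since the covariance depends on \<open>s - u\<close>, a forward step in \<open>u\<close>
  is a backward step in the lag: each difference in the second argument contributes a sign and a
  shift by \<open>- h\<close>.\<close>

lemma ip_nabla:
  assumes z: "\<And>s. z s \<in> G" and y: "\<And>s. y s \<in> G" and k: "\<And>s u. ip (z s) (y u) = k (s - u)"
  shows "ip (\<lambda>\<omega>. nabla h p (\<lambda>s. z s \<omega>) s) (\<lambda>\<omega>. nabla h q (\<lambda>s. y s \<omega>) u) =
    (-1) ^ q * nabla h (p + q) k (s - u - real q * h)"
proof -
  have 1: "ip (\<lambda>\<omega>. nabla h p (\<lambda>s. z s \<omega>) s) (y u) = nabla h p k (s - u)" for s u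
  proof (induction p arbitrary: s)
    case (Suc p)
    have "ip (\<lambda>\<omega>. nabla h (Suc p) (\<lambda>s. z s \<omega>) s) (y u) =
        ip (\<lambda>\<omega>. (1 / h) * (nabla h p (\<lambda>s. z s \<omega>) (s + h) - nabla h p (\<lambda>s. z s \<omega>) s)) (y u)"
      by (simp add: nabla_Suc' nabla1_def)
    also have "\<dots> = (1 / h) * (nabla h p k (s + h - u) - nabla h p k (s - u))"
      by (subst ip_scale_left, subst ip_diff_left) (use nabla_mem[OF z] y Suc.IH in auto)
    also have "\<dots> = nabla h (Suc p) k (s - u)"
      by (simp add: nabla_Suc' nabla1_def add_diff_eq diff_add_eq)
    finally show ?case .
  qed (use k in simp)
  show ?thesis
  proof (induction q arbitrary: u)
    case (Suc q)
    let ?z = "\<lambda>\<omega>. nabla h p (\<lambda>s. z s \<omega>) s"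
    have "ip ?z (\<lambda>\<omega>. nabla h (Suc q) (\<lambda>s. y s \<omega>) u) =
        ip ?z (\<lambda>\<omega>. (1 / h) * (nabla h q (\<lambda>s. y s \<omega>) (u + h) - nabla h q (\<lambda>s. y s \<omega>) u))"
      by (simp add: nabla_Suc' nabla1_def)
    also have "\<dots> = (1 / h) * ((-1) ^ q * nabla h (p + q) k (s - (u + h) - real q * h) -
        (-1) ^ q * nabla h (p + q) k (s - u - real q * h))"
      by (subst ip_scale_right, subst ip_diff_right) (use nabla_mem[OF z] nabla_mem[OF y] Suc.IH in auto)
    also have "\<dots> = (-1) ^ Suc q * nabla h (p + Suc q) k (s - u - real (Suc q) * h)"
    proof -
      have "s - (u + h) - real q * h = s - u - real (Suc q) * h"
        "s - u - real q * h = s - u - real (Suc q) * h + h"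
        by (simp_all add: algebra_simps)
      then show ?thesis by (simp only: add_Suc_right nabla_Suc' nabla1_def) (simp add: field_simps)
    qed
    finally show ?case .
  qed (use 1 in simp)
qed

end

section \<open>The Gaussian space of a Gaussian field\<close>

text \<open>For positive variance the moments are \<open>3 * \<sigma> ^ 4\<close> and
  \<open>\<sigma>\<^sup>2\<close>; for an almost surely constant variable both sides are 0.\<close>

lemma (in prob_space) gaussian_rv_centered_moments:
  assumes "gaussian_rv M X"
  shows "integrable M X"
    and "integrable M (\<lambda>\<omega>. (X \<omega> - expectation X) ^ 4)"
    and "expectation (\<lambda>\<omega>. (X \<omega> - expectation X) ^ 4) =
      3 * (expectation (\<lambda>\<omega>. (X \<omega> - expectation X) * (X \<omega> - expectation X)))\<^sup>2"
proof -
  have [measurable]: "X \<in> borel_measurable M" using assms by (simp add: gaussian_rv_def)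
  have "integrable M X \<and> integrable M (\<lambda>\<omega>. (X \<omega> - expectation X) ^ 4) \<and>
    expectation (\<lambda>\<omega>. (X \<omega> - expectation X) ^ 4) =
      3 * (expectation (\<lambda>\<omega>. (X \<omega> - expectation X) * (X \<omega> - expectation X)))\<^sup>2"
  proof -
    consider \<mu> \<sigma> where "\<sigma> > 0" "distributed M lborel X (\<lambda>x. ennreal (normal_density \<mu> \<sigma> x))"
      | \<mu> where "AE \<omega> in M. X \<omega> = \<mu>"
      using assms unfolding gaussian_rv_def by blast
    then show ?thesis
    proof cases
      case (1 \<mu> \<sigma>)
      note D = 1(2)
      have E: "expectation X = \<mu>" by (rule normal_distributed_expectation[OF 1])
      have "integrable M X"
        using distributed_integrable[OF D, of "\<lambda>x. x"] integrable_normal_moment_nz_1[OF 1(1), of \<mu>]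
        by simp
      moreover have "integrable M (\<lambda>\<omega>. (X \<omega> - \<mu>) ^ 4)"
        using distributed_integrable[OF D, of "\<lambda>x. (x - \<mu>) ^ 4"] integrable_normal_moment[OF 1(1), of \<mu> 4]
        by simp
      moreover have "expectation (\<lambda>\<omega>. (X \<omega> - \<mu>) ^ 4) = 3 * \<sigma> ^ 4"
        using distributed_integral[OF D, of "\<lambda>x. (x - \<mu>) ^ 4"] integral_normal_moment_even[OF 1(1), of \<mu> 2] 1(1)
        by (simp add: fact_numeral field_simps)
      moreover have "expectation (\<lambda>\<omega>. (X \<omega> - \<mu>) * (X \<omega> - \<mu>)) = \<sigma>\<^sup>2"
        using distributed_integral[OF D, of "\<lambda>x. (x - \<mu>) * (x - \<mu>)"] integral_normal_moment_even[OF 1(1), of \<mu> 1] 1(1)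
        by (simp add: fact_numeral field_simps power2_eq_square)
      ultimately show ?thesis by (simp add: E power_mult[symmetric])
    next
      case (2 \<mu>)
      have i: "integrable M X"
        using integrable_cong_AE[of X M "\<lambda>_. \<mu>"] 2 by simp
      have E: "expectation X = \<mu>"
        using integral_cong_AE[of X M "\<lambda>_. \<mu>"] 2 by (simp add: prob_space)
      have 4: "AE \<omega> in M. (X \<omega> - \<mu>) ^ 4 = 0" "AE \<omega> in M. (X \<omega> - \<mu>) * (X \<omega> - \<mu>) = 0"
        using 2 by auto
      have "integrable M (\<lambda>\<omega>. (X \<omega> - \<mu>) ^ 4)"
        using integrable_cong_AE[of "\<lambda>\<omega>. (X \<omega> - \<mu>) ^ 4" M "\<lambda>_. 0"] 4 by simp
      moreover have "expectation (\<lambda>\<omega>. (X \<omega> - \<mu>) ^ 4) = 0"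
        using integral_cong_AE[of "\<lambda>\<omega>. (X \<omega> - \<mu>) ^ 4" M "\<lambda>_. 0"] 4 by simp
      moreover have "expectation (\<lambda>\<omega>. (X \<omega> - \<mu>) * (X \<omega> - \<mu>)) = 0"
        using integral_cong_AE[of "\<lambda>\<omega>. (X \<omega> - \<mu>) * (X \<omega> - \<mu>)" M "\<lambda>_. 0"] 4 by simp
      ultimately show ?thesis using i E by simp
    qed
  qed
  then show "integrable M X" "integrable M (\<lambda>\<omega>. (X \<omega> - expectation X) ^ 4)"
    "expectation (\<lambda>\<omega>. (X \<omega> - expectation X) ^ 4) =
      3 * (expectation (\<lambda>\<omega>. (X \<omega> - expectation X) * (X \<omega> - expectation X)))\<^sup>2"
    by auto
qed

text \<open>Centring is built in so that \<open>ip\<close> becomes the covariance and the kurtosis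
  identity can hold for a field with non-zero mean.\<close>

definition centered_span :: "'a measure \<Rightarrow> (real \<Rightarrow> 'a \<Rightarrow> real^2) \<Rightarrow> ('a \<Rightarrow> real) set" where
  "centered_span M Z = {Y. \<exists>S a. finite S \<and>
     Y = (\<lambda>\<omega>. (\<Sum>s\<in>S. a s \<bullet> Z s \<omega>) - integral\<^sup>L M (\<lambda>\<omega>. \<Sum>s\<in>S. a s \<bullet> Z s \<omega>))}"

lemma gaussian_space_centered_span:
  assumes "prob_space M" "gaussian_field M Z"
  shows "gaussian_space M (centered_span M Z)"
proof -
  interpret prob_space M by fact
  define l where "l S a \<omega> = (\<Sum>s\<in>S. a s \<bullet> Z s \<omega>)" for S a \<omega>
  have g: "gaussian_rv M (l S a)" if "finite S" for S a
    using assms(2) that unfolding gaussian_field_def l_def[abs_def] by blast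
  have mem: "Y \<in> centered_span M Z \<longleftrightarrow>
      (\<exists>S a. finite S \<and> Y = (\<lambda>\<omega>. l S a \<omega> - expectation (l S a)))" for Y
    by (simp add: centered_span_def l_def[abs_def])
  have int: "integrable M (l S a)" if "finite S" for S a
    by (rule gaussian_rv_centered_moments(1)[OF g[OF that]])
  show ?thesis
  proof
    fix X assume "X \<in> centered_span M Z"
    then obtain S a where X: "finite S" "X = (\<lambda>\<omega>. l S a \<omega> - expectation (l S a))"
      unfolding mem by blast
    show "X \<in> borel_measurable M"
      unfolding X(2) using int[OF X(1), of a] by measurable
    show "integrable M (\<lambda>\<omega>. X \<omega> ^ 4)"
      "expectation (\<lambda>\<omega>. X \<omega> ^ 4) = 3 * (expectation (\<lambda>\<omega>. X \<omega> * X \<omega>))\<^sup>2"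
      unfolding X(2) by (rule gaussian_rv_centered_moments[OF g[OF X(1)]])+
    show "(\<lambda>\<omega>. r * X \<omega>) \<in> centered_span M Z" for r
    proof -
      have "l S (\<lambda>s. r *\<^sub>R a s) = (\<lambda>\<omega>. r * l S a \<omega>)"
        by (simp add: l_def fun_eq_iff sum_distrib_left)
      then have "(\<lambda>\<omega>. r * X \<omega>) = (\<lambda>\<omega>. l S (\<lambda>s. r *\<^sub>R a s) \<omega> - expectation (l S (\<lambda>s. r *\<^sub>R a s)))"
        by (simp add: X(2) algebra_simps)
      with X(1) show ?thesis unfolding mem by blast
    qed
    fix Y assume "Y \<in> centered_span M Z"
    then obtain T b where Y: "finite T" "Y = (\<lambda>\<omega>. l T b \<omega> - expectation (l T b))"
      unfolding mem by blast
    \<comment> \<open>Two combinations over different index sets are merged over the union, each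
      extended by 0.\<close>
    define c where "c s = (if s \<in> S then a s else 0) + (if s \<in> T then b s else 0)" for s
    have "l (S \<union> T) c \<omega> = l S a \<omega> + l T b \<omega>" for \<omega>
    proof -
      have "l (S \<union> T) c \<omega> = (\<Sum>s\<in>S \<union> T. (if s \<in> S then a s \<bullet> Z s \<omega> else 0)) +
          (\<Sum>s\<in>S \<union> T. (if s \<in> T then b s \<bullet> Z s \<omega> else 0))"
        by (simp add: l_def c_def sum.distrib[symmetric] inner_add_left if_distrib[of "\<lambda>x. x \<bullet> _"] cong: if_cong)
      also have "(\<Sum>s\<in>S \<union> T. (if s \<in> S then a s \<bullet> Z s \<omega> else 0)) = l S a \<omega>"
        unfolding l_def using X Y by (intro sum.mono_neutral_cong_right) auto
      also have "(\<Sum>s\<in>S \<union> T. (if s \<in> T then b s \<bullet> Z s \<omega> else 0)) = l T b \<omega>"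
        unfolding l_def using X Y by (intro sum.mono_neutral_cong_right) auto
      finally show ?thesis .
    qed
    then have e: "l (S \<union> T) c = (\<lambda>\<omega>. l S a \<omega> + l T b \<omega>)" by blast
    have "(\<lambda>\<omega>. X \<omega> + Y \<omega>) = (\<lambda>\<omega>. l (S \<union> T) c \<omega> - expectation (l (S \<union> T) c))"
      unfolding e X(2) Y(2) using int[OF X(1)] int[OF Y(1)] by (simp add: algebra_simps)
    then show "(\<lambda>\<omega>. X \<omega> + Y \<omega>) \<in> centered_span M Z"
      unfolding mem using X(1) Y(1) by blast
  qed
qed

lemma component_mem_centered_span:
  "(\<lambda>\<omega>. Z s \<omega> $ k - integral\<^sup>L M (\<lambda>\<omega>. Z s \<omega> $ k)) \<in> centered_span M Z"
  unfolding centered_span_def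
  by (intro CollectI exI[of _ "{s}"] exI[of _ "\<lambda>_. axis k 1"]) (simp add: inner_axis')

section \<open>Consistency and orthogonality\<close>

context gaussian_space
begin

text \<open>The bound on differences covers non-negative lags. For \<open>i < j\<close> the
  arguments are exchanged, which reflects the covariance; its evenness on \<open>{-L..L}\<close>,
  part of condition A even for a cross-covariance, undoes the reflection.\<close>

lemma ip_nabla_bound:
  assumes "L > 0" "condition_A L c \<alpha> k" "\<alpha> < 2 * real p"
    and z: "\<And>s. z s \<in> G" and y: "\<And>s. y s \<in> G" and k: "\<And>s u. ip (z s) (y u) = k (s - u)"
  shows "\<exists>C\<ge>0. \<forall>n i j. i + p \<le> n \<longrightarrow> j + p \<le> n \<longrightarrow>
    \<bar>ip (\<lambda>\<omega>. nabla (L / real n) p (\<lambda>s. z s \<omega>) (L / real n * real i))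
        (\<lambda>\<omega>. nabla (L / real n) p (\<lambda>s. y s \<omega>) (L / real n * real j))\<bar>
      \<le> C * (real (i - j + (j - i) + 1) * (L / real n)) powr (\<alpha> - 2 * real p)"
proof -
  have \<alpha>: "\<alpha> > 0" using assms(2) by (simp add: condition_A_def)
  have p: "p > 0" using \<alpha> assms(3) by (cases p) auto
  obtain C where C: "C \<ge> 0" and bound: "\<And>n m. m + p \<le> n \<Longrightarrow>
     \<bar>nabla (L / real n) (2 * p) k ((real m - real p) * (L / real n))\<bar>
       \<le> C * (real (m + 1) * (L / real n)) powr (\<alpha> - 2 * real p)"
    using nabla_condition_A_bound[OF assms(1-3)] by blast
  have main: "\<bar>ip (\<lambda>\<omega>. nabla h p (\<lambda>s. z s \<omega>) (h * real i)) (\<lambda>\<omega>. nabla h p (\<lambda>s. y s \<omega>) (h * real j))\<bar>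
      \<le> C * (real (i - j + (j - i) + 1) * h) powr (\<alpha> - 2 * real p)"
    if ij: "i + p \<le> n" "j + p \<le> n" and h_def: "h = L / real n" for n i j h
  proof (cases "j \<le> i")
    case True
    have "h * real i - h * real j - real p * h = (real (i - j) - real p) * h"
      using True by (simp add: algebra_simps of_nat_diff)
    then have "ip (\<lambda>\<omega>. nabla h p (\<lambda>s. z s \<omega>) (h * real i)) (\<lambda>\<omega>. nabla h p (\<lambda>s. y s \<omega>) (h * real j)) =
        (-1) ^ p * nabla h (2 * p) k ((real (i - j) - real p) * h)"
      by (subst ip_nabla[where z = z and y = y and k = k, OF z y k]) (simp add: mult_2)
    moreover have "i - j + p \<le> n" using ij by simp
    ultimately show ?thesis using bound[of "i - j" n] True h_def by (simp add: abs_mult)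
  next
    case False
    have n: "n > 0" using ij p by simp
    have h: "h > 0" "real n * h = L" using n assms(1) by (auto simp: h_def)
    have k': "ip (y s) (z u) = k (- (s - u))" for s u
      using k[of u s] by (simp add: ip_commute[of "y s"])
    have "h * real j - h * real i - real p * h = (real (j - i) - real p) * h"
      using False by (simp add: algebra_simps of_nat_diff)
    then have "ip (\<lambda>\<omega>. nabla h p (\<lambda>s. y s \<omega>) (h * real j)) (\<lambda>\<omega>. nabla h p (\<lambda>s. z s \<omega>) (h * real i)) =
        (-1) ^ p * nabla h (2 * p) (\<lambda>t. k (- t)) ((real (j - i) - real p) * h)"
      by (subst ip_nabla[where z = y and y = z and k = "\<lambda>t. k (- t)", OF y z k']) (simp add: mult_2)
    also have "nabla h (2 * p) (\<lambda>t. k (- t)) ((real (j - i) - real p) * h) =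
        nabla h (2 * p) k ((real (j - i) - real p) * h)"
    proof (rule nabla_cong)
      fix l assume l: "l \<le> 2 * p"
      define x where "x = real (j - i) - real p + real l"
      have "\<bar>x\<bar> \<le> real n" using l ij False by (auto simp: x_def)
      then have "\<bar>x\<bar> * h \<le> real n * h" using h by (intro mult_right_mono) auto
      then have "\<bar>x * h\<bar> \<le> L" using h by (simp add: abs_mult)
      then have "k (- (x * h)) = k (x * h)"
        by (intro condition_A_even[OF assms(2)]) auto
      then show "k (- ((real (j - i) - real p) * h + real l * h)) = k ((real (j - i) - real p) * h + real l * h)"
        by (simp add: x_def algebra_simps)
    qed
    moreover have "j - i + p \<le> n" using ij by simp
    ultimately show ?thesis using bound[of "j - i" n] False h_def
      by (subst ip_commute) (simp add: abs_mult)
  qed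
  show ?thesis using C main by blast
qed

lemma ip_nabla_limit:
  assumes "L > 0" "condition_A L c \<alpha> k" "\<alpha> < 2 * real p"
    and z: "\<And>s. z s \<in> G" and y: "\<And>s. y s \<in> G" and k: "\<And>s u. ip (z s) (y u) = k (s - u)"
  shows "(\<lambda>n. (L / real n) powr (2 * real p - \<alpha>) *
       ip (\<lambda>\<omega>. nabla (L / real n) p (\<lambda>s. z s \<omega>) 0) (\<lambda>\<omega>. nabla (L / real n) p (\<lambda>s. y s \<omega>) 0))
      \<longlonglongrightarrow> (-1) ^ p * (c * power_difference p \<alpha>)"
proof -
  have "ip (\<lambda>\<omega>. nabla h p (\<lambda>s. z s \<omega>) 0) (\<lambda>\<omega>. nabla h p (\<lambda>s. y s \<omega>) 0) =
      (-1) ^ p * nabla h (2 * p) k (- real p * h)" for h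
    by (subst ip_nabla[where z = z and y = y and k = k, OF z y k]) (simp add: mult_2)
  moreover have "(\<lambda>n. (-1) ^ p * ((L / real n) powr (2 * real p - \<alpha>) *
            nabla (L / real n) (2 * p) k (- real p * (L / real n))))
          \<longlonglongrightarrow> (-1) ^ p * (c * power_difference p \<alpha>)"
    by (intro tendsto_intros nabla_condition_A_limit assms)
  ultimately show ?thesis by (simp add: mult.left_commute)
qed

text \<open>Both parts of the bound in \<open>prob_ratio_le\<close> must vanish: the bias
  \<open>r / v\<close> does so because the limits for the two covariances at lag zero cancel, the
  variance part because \<open>d < 1\<close>.\<close>

lemma regression_error_tendsto_0:
  assumes L: "L > 0" and p: "\<alpha>\<^sub>1 < 2 * real p" and "\<epsilon> > 0"
    and x: "\<And>s. x s \<in> G" and y: "\<And>s. y s \<in> G"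
    and kxx: "\<And>s u. ip (x s) (x u) = kxx (s - u)" "condition_A L c \<alpha>\<^sub>1 kxx" "c \<noteq> 0"
    and kxy: "\<And>s u. ip (x s) (y u) = kxy (s - u)" "condition_A L (\<beta> * c) \<alpha>\<^sub>1 kxy"
    and kyy: "\<And>s u. ip (y s) (y u) = kyy (s - u)" "condition_A L c' \<alpha>\<^sub>2 kyy"
    and \<alpha>: "\<alpha>\<^sub>1 - 1 < \<alpha>\<^sub>2" "\<alpha>\<^sub>2 \<le> \<alpha>\<^sub>1"
    and X_def: "\<And>n j. X n j = (\<lambda>\<omega>. nabla (L / real n) p (\<lambda>s. x s \<omega>) (L / real n * real j))"
    and Y_def: "\<And>n j. Y n j = (\<lambda>\<omega>. nabla (L / real n) p (\<lambda>s. y s \<omega>) (L / real n * real j))"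
  shows "(\<lambda>n. prob {\<omega>\<in>space M. \<not> ((\<Sum>j<n+1-p. (X n j \<omega>)\<^sup>2) > 0 \<and>
        \<bar>(\<Sum>j<n+1-p. X n j \<omega> * (Y n j \<omega> - \<beta> * X n j \<omega>)) / (\<Sum>j<n+1-p. (X n j \<omega>)\<^sup>2)\<bar> \<le> \<epsilon>)}) \<longlonglongrightarrow> 0"
proof -
  have \<alpha>1: "\<alpha>\<^sub>1 > 0" using kxx by (simp add: condition_A_def)
  have p0: "p > 0" using \<alpha>1 p by (cases p) auto
  \<comment> \<open>The variance \<open>v n\<close> has the exact order \<open>h powr (- a)\<close>;
    the bound for \<open>Y\<close>, and hence for \<open>W\<close>, loses a further
    \<open>d\<close>, the gap in smoothness of the two components.\<close>
  define a where "a = 2 * real p - \<alpha>\<^sub>1"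
  define d where "d = \<alpha>\<^sub>1 - \<alpha>\<^sub>2"
  have ad: "a > 0" "0 \<le> d" "d < 1" using p \<alpha> by (auto simp: a_def d_def)
  have e1: "\<alpha>\<^sub>1 - 2 * real p = - a" "\<alpha>\<^sub>2 - 2 * real p = - (a + d)" by (simp_all add: a_def d_def)
  define y' where "y' n i j = real (i - j + (j - i) + 1) * (L / real n)" for n i j :: nat
  define W where "W n j = (\<lambda>\<omega>. Y n j \<omega> - \<beta> * X n j \<omega>)" for n j
  have XG: "X n j \<in> G" and YG: "Y n j \<in> G" for n j
    unfolding X_def Y_def by (intro nabla_mem x y)+
  have WG: "W n j \<in> G" for n j unfolding W_def by (intro diff scale XG YG)
  obtain C1 where C1: "C1 \<ge> 0" "\<And>n i j. i + p \<le> n \<Longrightarrow> j + p \<le> n \<Longrightarrow>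
      \<bar>ip (X n i) (X n j)\<bar> \<le> C1 * y' n i j powr (- a)"
    using ip_nabla_bound[OF L kxx(2) p x x kxx(1)] unfolding X_def y'_def e1 by blast
  obtain C2 where C2: "C2 \<ge> 0" "\<And>n i j. i + p \<le> n \<Longrightarrow> j + p \<le> n \<Longrightarrow>
      \<bar>ip (X n i) (Y n j)\<bar> \<le> C2 * y' n i j powr (- a)"
    using ip_nabla_bound[OF L kxy(2) p x y kxy(1)] unfolding X_def Y_def y'_def e1 by blast
  have p2: "\<alpha>\<^sub>2 < 2 * real p" using p \<alpha> by simp
  obtain C3 where C3: "C3 \<ge> 0" "\<And>n i j. i + p \<le> n \<Longrightarrow> j + p \<le> n \<Longrightarrow>
      \<bar>ip (Y n i) (Y n j)\<bar> \<le> C3 * y' n i j powr (- (a + d))"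
    using ip_nabla_bound[OF L kyy(2) p2 y y kyy(1)] unfolding Y_def y'_def e1 by blast
  define C4 where "C4 = C2 + \<bar>\<beta>\<bar> * C1"
  define C5 where "C5 = C3 + (2 * \<bar>\<beta>\<bar> * C2 + \<beta>\<^sup>2 * C1) * L powr d"
  \<comment> \<open>The summands serve \<open>t1\<close>, \<open>t2\<close> and \<open>t3\<close>.
    The factor \<open>L powr d\<close> is the cost of weakening the exponent \<open>- a\<close> to
    \<open>- (a + d)\<close>, possible since \<open>y'\<close> never exceeds
    \<open>L\<close>.\<close>
  define C where "C = C1 * C5 + C4\<^sup>2 * L powr d + 2 * C1\<^sup>2 * L powr d"
  have C45: "C4 \<ge> 0" "C5 \<ge> 0" using C1(1) C2(1) C3(1) by (simp_all add: C4_def C5_def)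
  have sym: "y' n i j = y' n j i" for n i j by (simp add: y'_def add.commute)
  have bXW: "\<bar>ip (X n i) (W n j)\<bar> \<le> C4 * y' n i j powr (- a)" if "i + p \<le> n" "j + p \<le> n" for n i j
  proof -
    have "ip (X n i) (W n j) = ip (X n i) (Y n j) - \<beta> * ip (X n i) (X n j)"
      unfolding W_def by (simp add: ip_simps XG YG scale)
    moreover have "\<bar>\<beta> * ip (X n i) (X n j)\<bar> \<le> \<bar>\<beta>\<bar> * (C1 * y' n i j powr (- a))"
      unfolding abs_mult by (intro mult_left_mono C1(2) that) auto
    ultimately show ?thesis
      using C2(2)[OF that] unfolding C4_def by (simp add: distrib_right mult.assoc)
  qed
  have bY: "y' n i j > 0 \<and> y' n i j powr (- a) \<le> L powr d * y' n i j powr (- (a + d))"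
    if "i + p \<le> n" "j + p \<le> n" for n i j
  proof -
    have n: "n > 0" using that p0 by simp
    have pos: "y' n i j > 0" using n L by (simp add: y'_def)
    have "i - j + (j - i) + 1 \<le> n" using that p0 by auto
    then have "y' n i j \<le> real n * (L / real n)"
      unfolding y'_def using L n by (intro mult_right_mono) auto
    then have "y' n i j powr d \<le> L powr d" using n pos ad by (intro powr_mono2) auto
    then have "y' n i j powr d * y' n i j powr (- (a + d)) \<le> L powr d * y' n i j powr (- (a + d))"
      by (intro mult_right_mono) auto
    then show ?thesis using pos by (simp add: powr_add[symmetric])
  qed
  have bWW: "\<bar>ip (W n i) (W n j)\<bar> \<le> C5 * y' n i j powr (- (a + d))" if "i + p \<le> n" "j + p \<le> n" for n i j
  proof -
    have "ip (W n i) (W n j) = ip (Y n i) (Y n j) - \<beta> * ip (X n i) (Y n j) - \<beta> * ip (X n j) (Y n i) + \<beta>\<^sup>2 * ip (X n i) (X n j)"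
      unfolding W_def
      by (simp add: ip_simps XG YG scale diff ip_commute[of "Y n i" "X n j"])
         (simp add: power2_eq_square right_diff_distrib)
    moreover have "\<bar>\<beta> * ip (X n i) (Y n j)\<bar> \<le> \<bar>\<beta>\<bar> * (C2 * y' n i j powr (- a))"
      unfolding abs_mult by (intro mult_left_mono C2(2) that) auto
    moreover have "\<bar>\<beta> * ip (X n j) (Y n i)\<bar> \<le> \<bar>\<beta>\<bar> * (C2 * y' n i j powr (- a))"
      unfolding abs_mult sym[of n i j] by (intro mult_left_mono C2(2) that) auto
    moreover have "\<bar>\<beta>\<^sup>2 * ip (X n i) (X n j)\<bar> \<le> \<beta>\<^sup>2 * (C1 * y' n i j powr (- a))"
      unfolding abs_mult abs_power2 by (intro mult_left_mono C1(2) that) auto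
    ultimately have "\<bar>ip (W n i) (W n j)\<bar> \<le> C3 * y' n i j powr (- (a + d)) +
        (2 * \<bar>\<beta>\<bar> * C2 + \<beta>\<^sup>2 * C1) * y' n i j powr (- a)"
      using C3(2)[OF that] by (simp add: distrib_right mult.assoc)
    also have "\<dots> \<le> C3 * y' n i j powr (- (a + d)) +
        (2 * \<bar>\<beta>\<bar> * C2 + \<beta>\<^sup>2 * C1) * (L powr d * y' n i j powr (- (a + d)))"
      using C1(1) C2(1) bY[OF that] by (intro add_left_mono mult_left_mono) auto
    finally show ?thesis by (simp add: C5_def distrib_right mult.assoc)
  qed
  \<comment> \<open>The exponent is that of the worst product, a covariance of \<open>X\<close> with
    \<open>X\<close> times one of \<open>W\<close> with \<open>W\<close>.\<close>
  define g where "g n m = (real (m + 1) * (L / real n)) powr (- (2 * a + d))" for n m :: nat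
  have bound: "\<bar>ip (X n i) (X n j)\<bar> * \<bar>ip (W n i) (W n j)\<bar> + \<bar>ip (X n i) (W n j)\<bar> * \<bar>ip (W n i) (X n j)\<bar>
       \<le> C * g n (i - j + (j - i))"
    and bound': "2 * (ip (X n i) (X n j))\<^sup>2 \<le> C * g n (i - j + (j - i))"
    if ij: "i + p \<le> n" "j + p \<le> n" for n i j
  proof -
    define u where "u = y' n i j"
    have u: "u > 0" "u powr (- a) \<le> L powr d * u powr (- (a + d))" using bY[OF ij] by (auto simp: u_def)
    have g: "g n (i - j + (j - i)) = u powr (- (2 * a + d))" by (simp add: g_def u_def y'_def)
    have m1: "u powr (- a) * u powr (- (a + d)) = u powr (- (2 * a + d))"
      by (simp add: powr_add[symmetric])
    have m2: "u powr (- a) * u powr (- a) \<le> L powr d * u powr (- (2 * a + d))"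
    proof -
      have "u powr (- a) * u powr (- a) \<le> u powr (- a) * (L powr d * u powr (- (a + d)))"
        by (intro mult_left_mono u) auto
      then show ?thesis unfolding m1[symmetric] by (simp add: mult.left_commute)
    qed
    have t1: "\<bar>ip (X n i) (X n j)\<bar> * \<bar>ip (W n i) (W n j)\<bar> \<le> C1 * C5 * u powr (- (2 * a + d))"
    proof -
      have "\<bar>ip (X n i) (X n j)\<bar> * \<bar>ip (W n i) (W n j)\<bar> \<le> (C1 * u powr (- a)) * (C5 * u powr (- (a + d)))"
        unfolding u_def using C1(1) by (intro mult_mono C1(2) bWW ij) auto
      then show ?thesis unfolding m1[symmetric] by (simp add: ac_simps)
    qed
    have t2: "\<bar>ip (X n i) (W n j)\<bar> * \<bar>ip (W n i) (X n j)\<bar> \<le> C4\<^sup>2 * L powr d * u powr (- (2 * a + d))"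
    proof -
      have "\<bar>ip (X n i) (W n j)\<bar> * \<bar>ip (W n i) (X n j)\<bar> \<le> (C4 * u powr (- a)) * (C4 * u powr (- a))"
        unfolding u_def ip_commute[of "W n i"] using C45 bXW[OF ij] bXW[OF ij(2,1)]
        by (intro mult_mono) (auto simp: sym[of n j i])
      also have "\<dots> = C4\<^sup>2 * (u powr (- a) * u powr (- a))" by (simp add: power2_eq_square)
      also have "\<dots> \<le> C4\<^sup>2 * (L powr d * u powr (- (2 * a + d)))" by (intro mult_left_mono m2) auto
      finally show ?thesis by (simp add: mult.assoc)
    qed
    have t3: "2 * (ip (X n i) (X n j))\<^sup>2 \<le> 2 * C1\<^sup>2 * L powr d * u powr (- (2 * a + d))"
    proof -
      have "(ip (X n i) (X n j))\<^sup>2 = \<bar>ip (X n i) (X n j)\<bar> * \<bar>ip (X n i) (X n j)\<bar>"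
        by (simp add: power2_eq_square)
      also have "\<dots> \<le> (C1 * u powr (- a)) * (C1 * u powr (- a))"
        unfolding u_def using C1(1) by (intro mult_mono C1(2) ij) auto
      also have "\<dots> = C1\<^sup>2 * (u powr (- a) * u powr (- a))" by (simp add: power2_eq_square)
      also have "\<dots> \<le> C1\<^sup>2 * (L powr d * u powr (- (2 * a + d)))" by (intro mult_left_mono m2) auto
      finally show ?thesis by (simp add: mult.assoc)
    qed
    have nn: "0 \<le> C1 * C5 * u powr (- (2 * a + d))" "0 \<le> C4\<^sup>2 * L powr d * u powr (- (2 * a + d))"
      "0 \<le> 2 * C1\<^sup>2 * L powr d * u powr (- (2 * a + d))"
      using C1(1) C45 by auto
    show "\<bar>ip (X n i) (X n j)\<bar> * \<bar>ip (W n i) (W n j)\<bar> + \<bar>ip (X n i) (W n j)\<bar> * \<bar>ip (W n i) (X n j)\<bar>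
       \<le> C * g n (i - j + (j - i))"
      unfolding g C_def distrib_right using t1 t2 nn by linarith
    show "2 * (ip (X n i) (X n j))\<^sup>2 \<le> C * g n (i - j + (j - i))"
      unfolding g C_def distrib_right using t3 nn by linarith
  qed
  have C0: "C \<ge> 0" using C1(1) C45 by (simp add: C_def)
  define B where "B n = C * (2 * real (n + 1 - p) * (\<Sum>m<n+1-p. g n m))" for n
  have sumB: "(\<Sum>j<n+1-p. \<Sum>k<n+1-p. F j k) \<le> B n"
    if "\<And>j k. j + p \<le> n \<Longrightarrow> k + p \<le> n \<Longrightarrow> F j k \<le> C * g n (j - k + (k - j))" for F n
  proof -
    have "(\<Sum>j<n+1-p. \<Sum>k<n+1-p. F j k) \<le> (\<Sum>j<n+1-p. \<Sum>k<n+1-p. C * g n (j - k + (k - j)))"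
      by (intro sum_mono that) auto
    also have "\<dots> = C * (\<Sum>j<n+1-p. \<Sum>k<n+1-p. g n (j - k + (k - j)))"
      by (simp add: sum_distrib_left)
    also have "\<dots> \<le> B n"
      unfolding B_def by (intro mult_left_mono sum_abs_diff_le C0) (simp add: g_def)
    finally show ?thesis .
  qed
  define v where "v n = ip (X n 0) (X n 0)" for n
  define r where "r n = ip (X n 0) (W n 0)" for n
  define h where "h n = L / real n" for n
  have stat: "ip (X n j) (X n j) = v n" "ip (X n j) (Y n j) = ip (X n 0) (Y n 0)" for n j
    unfolding v_def X_def Y_def by (simp_all add: ip_nabla[where z = x and y = x and k = kxx, OF x x kxx(1)] ip_nabla[where z = x and y = y and k = kxy, OF x y kxy(1)])
  have XW: "ip (X n j) (W n j) = ip (X n j) (Y n j) - \<beta> * ip (X n j) (X n j)" for n j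
    unfolding W_def by (simp add: ip_simps XG YG scale)
  have rj: "ip (X n j) (W n j) = r n" for n j
    unfolding r_def XW stat[of n j] by (simp add: v_def)
  define \<kappa> where "\<kappa> = (-1) ^ p * (c * power_difference p \<alpha>\<^sub>1)"
  have \<kappa>: "\<kappa> \<noteq> 0"
  proof -
    have "\<alpha>\<^sub>1 \<noteq> 2 * real i" for i
    proof
      assume "\<alpha>\<^sub>1 = 2 * real i"
      then have "even (2 * int i) \<and> \<alpha>\<^sub>1 = of_int (2 * int i)" by simp
      then show False using kxx(2) unfolding condition_A_def by blast
    qed
    then show ?thesis using power_difference_nonzero[OF p0 \<alpha>1] kxx(3) by (simp add: \<kappa>_def)
  qed
  have limv: "(\<lambda>n. h n powr a * v n) \<longlonglongrightarrow> \<kappa>"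
    using ip_nabla_limit[OF L kxx(2) p x x kxx(1)] by (simp add: \<kappa>_def v_def X_def h_def a_def)
  have limr: "(\<lambda>n. h n powr a * r n) \<longlonglongrightarrow> 0"
  proof -
    have "(\<lambda>n. h n powr a * ip (X n 0) (Y n 0)) \<longlonglongrightarrow> \<beta> * \<kappa>"
      using ip_nabla_limit[OF L kxy(2) p x y kxy(1)]
      by (simp add: \<kappa>_def X_def Y_def h_def a_def ac_simps)
    then have "(\<lambda>n. h n powr a * ip (X n 0) (Y n 0) - \<beta> * (h n powr a * v n)) \<longlonglongrightarrow> \<beta> * \<kappa> - \<beta> * \<kappa>"
      by (intro tendsto_diff tendsto_mult_left limv)
    moreover have "h n powr a * r n = h n powr a * ip (X n 0) (Y n 0) - \<beta> * (h n powr a * v n)" for n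
      unfolding r_def XW v_def by (simp add: right_diff_distrib)
    ultimately show ?thesis by simp
  qed
  \<comment> \<open>The sign of \<open>\<kappa>\<close> is never computed: \<open>v n\<close> is a
    second moment, hence non-negative, and a non-zero limit rules out 0.\<close>
  have vpos: "\<forall>\<^sub>F n in sequentially. v n > 0"
    using tendsto_imp_eventually_ne[OF limv \<kappa>]
  proof eventually_elim
    case (elim n)
    have "v n \<ge> 0" unfolding v_def by (intro Bochner_Integration.integral_nonneg) simp
    then show ?case using elim by (cases "v n = 0") auto
  qed
  have limrv: "(\<lambda>n. (r n / v n)\<^sup>2) \<longlonglongrightarrow> 0"
  proof -
    have "(\<lambda>n. ((h n powr a * r n) / (h n powr a * v n))\<^sup>2) \<longlonglongrightarrow> (0 / \<kappa>)\<^sup>2"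
      by (intro tendsto_intros limr limv \<kappa>)
    then have l: "(\<lambda>n. ((h n powr a * r n) / (h n powr a * v n))\<^sup>2) \<longlonglongrightarrow> 0" by simp
    show ?thesis
      by (rule Lim_transform_eventually[OF l], rule eventually_mono[OF eventually_gt_at_top[of 0]])
         (use L in \<open>simp add: h_def\<close>)
  qed
  have limB: "(\<lambda>n. B n / (real (n + 1 - p) * v n)\<^sup>2) \<longlonglongrightarrow> 0"
  proof -
    \<comment> \<open>The target quotient, extended by \<open>h powr (2 * a)\<close>: the
      denominator then converges to \<open>\<kappa>\<^sup>2\<close> and the numerator is the average
      treated in \<open>average_powr_tendsto_0\<close>.\<close>
    have "(\<lambda>n. 2 * C * (h n powr (2 * a) * (\<Sum>m<n+1-p. g n m) / real (n + 1 - p)) / (h n powr a * v n)\<^sup>2)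
        \<longlonglongrightarrow> 2 * C * 0 / \<kappa>\<^sup>2"
      unfolding g_def h_def
      by (intro tendsto_intros average_powr_tendsto_0 limv[unfolded h_def] L ad) (use \<kappa> in auto)
    then have l: "(\<lambda>n. 2 * C * (h n powr (2 * a) * (\<Sum>m<n+1-p. g n m) / real (n + 1 - p)) / (h n powr a * v n)\<^sup>2)
        \<longlonglongrightarrow> 0" by simp
    show ?thesis
    proof (rule Lim_transform_eventually[OF l], rule eventually_mono[OF eventually_gt_at_top[of p]])
      fix n assume n: "p < n"
      then have h: "h n > 0" using L by (simp add: h_def)
      have "h n powr (2 * a) = (h n powr a)\<^sup>2" using h by (simp add: powr_add[symmetric] power2_eq_square)
      moreover have "real (n + 1 - p) \<noteq> 0" "h n powr a \<noteq> 0" using n h by auto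
      moreover have "2 * C * (q\<^sup>2 * \<Sigma> / T) / (q * w)\<^sup>2 = C * (2 * T * \<Sigma>) / (T * w)\<^sup>2"
        if "T \<noteq> 0" "q \<noteq> 0" for q \<Sigma> T w :: real
        using that by (simp add: power2_eq_square ac_simps)
      ultimately show "2 * C * (h n powr (2 * a) * (\<Sum>m<n+1-p. g n m) / real (n + 1 - p)) / (h n powr a * v n)\<^sup>2 =
          B n / (real (n + 1 - p) * v n)\<^sup>2"
        unfolding B_def by metis
    qed
  qed
  show ?thesis
  proof (rule Lim_null_comparison)
    show "\<forall>\<^sub>F n in sequentially. norm (prob {\<omega>\<in>space M. \<not> ((\<Sum>j<n+1-p. (X n j \<omega>)\<^sup>2) > 0 \<and>
        \<bar>(\<Sum>j<n+1-p. X n j \<omega> * (Y n j \<omega> - \<beta> * X n j \<omega>)) / (\<Sum>j<n+1-p. (X n j \<omega>)\<^sup>2)\<bar> \<le> \<epsilon>)}) \<le>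
        4 * (B n / (real (n + 1 - p) * v n)\<^sup>2) +
        4 / \<epsilon>\<^sup>2 * ((r n / v n)\<^sup>2 + B n / (real (n + 1 - p) * v n)\<^sup>2)"
      using vpos eventually_ge_at_top[of p]
    proof eventually_elim
      case (elim n)
      have "prob {\<omega>\<in>space M. \<not> ((\<Sum>j<n+1-p. (X n j \<omega>)\<^sup>2) > 0 \<and>
        \<bar>(\<Sum>j<n+1-p. X n j \<omega> * W n j \<omega>) / (\<Sum>j<n+1-p. (X n j \<omega>)\<^sup>2)\<bar> \<le> \<epsilon>)} \<le>
        4 * B n / (real (n + 1 - p) * v n)\<^sup>2 +
        4 / \<epsilon>\<^sup>2 * ((r n / v n)\<^sup>2 + B n / (real (n + 1 - p) * v n)\<^sup>2)"
      proof (rule prob_ratio_le)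
        show "(\<Sum>j<n+1-p. \<Sum>k<n+1-p. \<bar>ip (X n j) (X n k)\<bar> * \<bar>ip (W n j) (W n k)\<bar> +
            \<bar>ip (X n j) (W n k)\<bar> * \<bar>ip (W n j) (X n k)\<bar>) \<le> B n"
          by (intro sumB bound)
        show "(\<Sum>j<n+1-p. \<Sum>k<n+1-p. 2 * (ip (X n j) (X n k))\<^sup>2) \<le> B n"
          by (intro sumB bound')
      qed (use elim \<open>\<epsilon> > 0\<close> XG WG stat rj in auto)
      then show ?case by (simp add: W_def)
    qed
    have "(\<lambda>n. 4 * (B n / (real (n + 1 - p) * v n)\<^sup>2) +
        4 / \<epsilon>\<^sup>2 * ((r n / v n)\<^sup>2 + B n / (real (n + 1 - p) * v n)\<^sup>2)) \<longlonglongrightarrow> 4 * 0 + 4 / \<epsilon>\<^sup>2 * (0 + 0)"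
      by (intro tendsto_intros limB limrv)
    then show "(\<lambda>n. 4 * (B n / (real (n + 1 - p) * v n)\<^sup>2) +
        4 / \<epsilon>\<^sup>2 * ((r n / v n)\<^sup>2 + B n / (real (n + 1 - p) * v n)\<^sup>2)) \<longlonglongrightarrow> 0" by simp
  qed
qed

end

section \<open>The estimator as a function of the path\<close>

lemma borel_measurable_nabla:
  assumes "\<And>s. (\<lambda>\<omega>. f s \<omega>) \<in> borel_measurable M"
  shows "(\<lambda>\<omega>. nabla h q (\<lambda>s. f s \<omega>) s) \<in> borel_measurable M"
  unfolding nabla_eq_sum
  by (intro borel_measurable_divide borel_measurable_sum borel_measurable_times
      borel_measurable_const assms)

lemma borel_measurable_vec_component:
  fixes f :: "'a \<Rightarrow> real^'n"
  assumes "f \<in> borel_measurable M"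
  shows "(\<lambda>\<omega>. f \<omega> $ k) \<in> borel_measurable M"
  by (rule measurable_compose[OF assms borel_measurable_continuous_onI]) (intro continuous_intros)

lemma borel_measurable_OLS:
  assumes "\<And>s. (\<lambda>\<omega>. x s \<omega>) \<in> borel_measurable M" "\<And>s. (\<lambda>\<omega>. y s \<omega>) \<in> borel_measurable M"
  shows "(\<lambda>\<omega>. OLS L p n (\<lambda>s. y s \<omega>) (\<lambda>s. x s \<omega>)) \<in> borel_measurable M"
  unfolding OLS_def Let_def
  by (intro borel_measurable_divide borel_measurable_sum borel_measurable_times
      borel_measurable_power borel_measurable_nabla assms)

text \<open>All nodes are of the form \<open>(j + i) h\<close> with \<open>j + i \<le> n\<close>, so
  the estimator is determined by the path on \<open>{0..L}\<close>, the only part that the path law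
  retains.\<close>

lemma OLS_cong:
  assumes "L \<ge> 0" "\<And>s. s \<in> {0..L} \<Longrightarrow> x s = x' s" "\<And>s. s \<in> {0..L} \<Longrightarrow> y s = y' s"
  shows "OLS L p n y x = OLS L p n y' x'"
proof -
  define h where "h = L / real n"
  \<comment> \<open>Only an inequality, because \<open>h\<close> is 0 for
    \<open>n = 0\<close>.\<close>
  have h: "h \<ge> 0" "real n * h \<le> L" using assms(1) by (auto simp: h_def)
  have eq: "nabla h p f (h * real j) = nabla h p f' (h * real j)"
    if f: "\<And>s. s \<in> {0..L} \<Longrightarrow> f s = f' s" and j: "j < n + 1 - p" for f f' :: "real \<Rightarrow> real" and j
  proof (rule nabla_cong, rule f)
    fix i assume "i \<le> p"
    then have "(real j + real i) * h \<le> real n * h" using j h by (intro mult_right_mono) auto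
    then show "h * real j + real i * h \<in> {0..L}" using h by (auto simp: algebra_simps)
  qed
  have "nabla h p x (h * real j) = nabla h p x' (h * real j)"
    "nabla h p y (h * real j) = nabla h p y' (h * real j)" if "j < n + 1 - p" for j
    by (rule eq; use assms that in blast)+
  then show ?thesis
    unfolding OLS_def Let_def h_def[symmetric] by simp
qed

lemma OLS_consistent:
  assumes "L > 0" "stationary_gaussian_field M Z K" "regression_covariance L K c \<alpha> \<beta>"
    and p: "\<alpha> $ 1 $ 1 < 2 * real p"
  shows "converges_in_probability M (\<lambda>n \<omega>. OLS L p n (\<lambda>s. Z s \<omega> $ 2) (\<lambda>s. Z s \<omega> $ 1)) \<beta>"
proof -
  obtain m where m: "\<And>s k. integral\<^sup>L M (\<lambda>\<omega>. Z s \<omega> $ k) = m $ k"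
    using assms(2) unfolding stationary_gaussian_field_def by blast
  have ps: "prob_space M" "gaussian_field M Z"
    using assms(2) by (auto simp: stationary_gaussian_field_def)
  interpret gaussian_space M "centered_span M Z"
    by (rule gaussian_space_centered_span[OF ps])
  have Zm [measurable]: "(\<lambda>\<omega>. Z s \<omega> $ k) \<in> borel_measurable M" for s k
    using ps(2) by (intro borel_measurable_vec_component) (simp add: gaussian_field_def)
  define z where "z k s \<omega> = Z s \<omega> $ k - m $ k" for k s \<omega>
  have zG: "z k s \<in> centered_span M Z" for k s
    using component_mem_centered_span[of Z s k M] unfolding m z_def .
  have ip: "ip (z k s) (z l u) = K (s - u) $ k $ l" for k l s u
  proof -
    have "cov M (\<lambda>\<omega>. Z (u + (s - u)) \<omega> $ k) (\<lambda>\<omega>. Z u \<omega> $ l) = K (s - u) $ k $ l"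
      using assms(2) unfolding stationary_gaussian_field_def by blast
    then show ?thesis unfolding cov_def m z_def by simp
  qed
  have cA: "condition_A L (c $ k $ l) (\<alpha> $ k $ l) (\<lambda>t. K t $ k $ l)" for k l
    using assms(3) by (simp add: regression_covariance_def)
  have rc: "c $ 1 $ 1 \<noteq> 0" "\<alpha> $ 1 $ 2 = \<alpha> $ 1 $ 1" "c $ 1 $ 2 = \<beta> * c $ 1 $ 1"
     "\<alpha> $ 1 $ 1 - 1 < \<alpha> $ 2 $ 2" "\<alpha> $ 2 $ 2 \<le> \<alpha> $ 1 $ 1"
    using assms(3) by (auto simp: regression_covariance_def)
  have cA12: "condition_A L (\<beta> * c $ 1 $ 1) (\<alpha> $ 1 $ 1) (\<lambda>t. K t $ 1 $ 2)"
    using cA[of 1 2] unfolding rc .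
  have p0: "p > 0" using p cA[of 1 1] by (cases p) (auto simp: condition_A_def)
  define X where "X n j = (\<lambda>\<omega>. nabla (L / real n) p (\<lambda>s. z 1 s \<omega>) (L / real n * real j))" for n j
  define Y where "Y n j = (\<lambda>\<omega>. nabla (L / real n) p (\<lambda>s. z 2 s \<omega>) (L / real n * real j))" for n j
  have XYG: "X n j \<in> centered_span M Z" "Y n j \<in> centered_span M Z" for n j
    unfolding X_def Y_def by (intro nabla_mem zG)+
  have [measurable]: "X n j \<in> borel_measurable M" "Y n j \<in> borel_measurable M" for n j
    using XYG by (auto intro: meas)
  \<comment> \<open>As \<open>p > 0\<close>, differences remove the unknown constant mean, so the
    estimator does not see the centring.\<close>
  have nz: "nabla h p (\<lambda>s. Z s \<omega> $ k) s = nabla h p (\<lambda>s. z k s \<omega>) s" for h k s \<omega>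
    using nabla_add[of h p "\<lambda>s. z k s \<omega>" "\<lambda>_. m $ k" s] nabla_const[OF p0] by (simp add: z_def)
  have OLS: "OLS L p n (\<lambda>s. Z s \<omega> $ 2) (\<lambda>s. Z s \<omega> $ 1) =
      (\<Sum>j<n+1-p. X n j \<omega> * Y n j \<omega>) / (\<Sum>j<n+1-p. (X n j \<omega>)\<^sup>2)" for n \<omega>
    by (simp add: OLS_def Let_def nz X_def Y_def)
  show ?thesis
    unfolding converges_in_probability_def
  proof (intro conjI allI impI)
    show "(\<lambda>\<omega>. OLS L p n (\<lambda>s. Z s \<omega> $ 2) (\<lambda>s. Z s \<omega> $ 1)) \<in> borel_measurable M" for n
      by (intro borel_measurable_OLS Zm)
    fix \<epsilon> :: real assume \<epsilon>: "\<epsilon> > 0"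
    \<comment> \<open>\<open>A n\<close> includes the outcomes with zero denominator, for which the
      error of the estimator need not equal the ratio of sums.\<close>
    define A where "A n = {\<omega>\<in>space M. \<not> ((\<Sum>j<n+1-p. (X n j \<omega>)\<^sup>2) > 0 \<and>
        \<bar>(\<Sum>j<n+1-p. X n j \<omega> * (Y n j \<omega> - \<beta> * X n j \<omega>)) / (\<Sum>j<n+1-p. (X n j \<omega>)\<^sup>2)\<bar> \<le> \<epsilon>)}" for n
    have lim: "(\<lambda>n. prob (A n)) \<longlonglongrightarrow> 0"
      unfolding A_def
      by (rule regression_error_tendsto_0[OF assms(1) p \<epsilon> zG zG ip cA rc(1) ip cA12 ip cA rc(4,5) X_def Y_def])
    show "(\<lambda>n. prob {\<omega>\<in>space M. \<bar>OLS L p n (\<lambda>s. Z s \<omega> $ 2) (\<lambda>s. Z s \<omega> $ 1) - \<beta>\<bar> > \<epsilon>}) \<longlonglongrightarrow> 0"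
    proof (rule tendsto_sandwich[OF _ _ tendsto_const lim])
      show "\<forall>\<^sub>F n in sequentially. prob {\<omega>\<in>space M. \<bar>OLS L p n (\<lambda>s. Z s \<omega> $ 2) (\<lambda>s. Z s \<omega> $ 1) - \<beta>\<bar> > \<epsilon>} \<le> prob (A n)"
      proof (intro always_eventually allI finite_measure_mono)
        fix n
        show "A n \<in> events" unfolding A_def by measurable
        show "{\<omega>\<in>space M. \<bar>OLS L p n (\<lambda>s. Z s \<omega> $ 2) (\<lambda>s. Z s \<omega> $ 1) - \<beta>\<bar> > \<epsilon>} \<subseteq> A n"
        proof
          fix \<omega> assume w: "\<omega> \<in> {\<omega>\<in>space M. \<bar>OLS L p n (\<lambda>s. Z s \<omega> $ 2) (\<lambda>s. Z s \<omega> $ 1) - \<beta>\<bar> > \<epsilon>}"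
          define S where "S = (\<Sum>j<n+1-p. (X n j \<omega>)\<^sup>2)"
          have "(\<Sum>j<n+1-p. X n j \<omega> * (Y n j \<omega> - \<beta> * X n j \<omega>)) =
              (\<Sum>j<n+1-p. X n j \<omega> * Y n j \<omega>) - \<beta> * S"
            by (simp add: S_def sum_distrib_left sum_subtractf power2_eq_square algebra_simps)
          then have e: "(\<Sum>j<n+1-p. X n j \<omega> * (Y n j \<omega> - \<beta> * X n j \<omega>)) / S =
              OLS L p n (\<lambda>s. Z s \<omega> $ 2) (\<lambda>s. Z s \<omega> $ 1) - \<beta>" if "S > 0"
            using that unfolding OLS S_def[symmetric] by (simp add: diff_divide_distrib)
          have "\<not> (S > 0 \<and> \<bar>(\<Sum>j<n+1-p. X n j \<omega> * (Y n j \<omega> - \<beta> * X n j \<omega>)) / S\<bar> \<le> \<epsilon>)"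
          proof
            assume a: "S > 0 \<and> \<bar>(\<Sum>j<n+1-p. X n j \<omega> * (Y n j \<omega> - \<beta> * X n j \<omega>)) / S\<bar> \<le> \<epsilon>"
            have "\<bar>OLS L p n (\<lambda>s. Z s \<omega> $ 2) (\<lambda>s. Z s \<omega> $ 1) - \<beta>\<bar> \<le> \<epsilon>"
              using conjunct2[OF a] unfolding e[OF conjunct1[OF a]] .
            with w show False by simp
          qed
          then show "\<omega> \<in> A n" using w unfolding A_def S_def by blast
        qed
      qed
    qed auto
  qed
qed

section \<open>From consistency to orthogonality\<close>

text \<open>Convergence to 0 gives no summability, so a single sequence of indices is chosen along
  which both probabilities are below \<open>(1/2) ^ k\<close>; the Borel-Cantelli lemma then applies
  under both measures.\<close>

lemma orthogonal_measuresI: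
  assumes "prob_space P" "prob_space Q" "sets P = sets Q"
    and E: "\<And>n. E n \<in> sets P"
    and P: "(\<lambda>n. measure P (E n)) \<longlonglongrightarrow> 0" and Q: "(\<lambda>n. measure Q (space Q - E n)) \<longlonglongrightarrow> 0"
  shows "orthogonal_measures P Q"
proof -
  interpret P: prob_space P by fact
  interpret Q: prob_space Q by fact
  have EQ: "E n \<in> sets Q" for n using E assms(3) by simp
  have sp: "space P = space Q" by (rule sets_eq_imp_space_eq) fact
  have "\<exists>n. measure P (E n) < (1/2) ^ k \<and> measure Q (space Q - E n) < (1/2) ^ k" for k :: nat
  proof -
    have "\<forall>\<^sub>F n in sequentially. measure P (E n) < (1/2) ^ k \<and> measure Q (space Q - E n) < (1/2) ^ k"
      by (intro eventually_conj order_tendstoD(2)[OF P] order_tendstoD(2)[OF Q]) auto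
    then show ?thesis by (rule eventually_happens'[OF sequentially_bot])
  qed
  then obtain r where r: "\<And>k. measure P (E (r k)) < (1/2) ^ k" "\<And>k. measure Q (space Q - E (r k)) < (1/2) ^ k"
    by metis
  have summ: "summable (\<lambda>k. f k)" if "\<And>k. 0 \<le> f k" "\<And>k. f k < (1/2) ^ k" for f :: "nat \<Rightarrow> real"
    by (rule summable_comparison_test'[where g = "\<lambda>k. (1/2) ^ k" and N = 0])
       (use that in \<open>auto intro: less_imp_le\<close>)
  have aP: "AE x in P. \<forall>\<^sub>F k in sequentially. x \<in> space P - E (r k)"
    by (rule borel_cantelli_AE1) (use E r summ in \<open>auto simp: less_top[symmetric]\<close>)
  have aQ: "AE x in Q. \<forall>\<^sub>F k in sequentially. x \<in> space Q - (space Q - E (r k))"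
    by (rule borel_cantelli_AE1) (use EQ r summ in \<open>auto simp: less_top[symmetric]\<close>)
  \<comment> \<open>The lower limit of the events: almost every point is eventually outside
    \<open>E (r k)\<close> under \<open>P\<close> and eventually inside under
    \<open>Q\<close>.\<close>
  define F where "F = (\<Union>N. \<Inter>k\<in>{N..}. E (r k))"
  have F: "F \<in> sets P" unfolding F_def using E by auto
  have memF: "x \<in> F \<longleftrightarrow> (\<forall>\<^sub>F k in sequentially. x \<in> E (r k))" for x
    by (auto simp: F_def eventually_sequentially)
  have "AE x in P. x \<notin> F"
    using aP
  proof eventually_elim
    case (elim x)
    show ?case
    proof
      assume "x \<in> F"
      then have "\<forall>\<^sub>F k in sequentially. x \<in> E (r k)" by (simp add: memF)
      with elim have "\<forall>\<^sub>F k in sequentially. False" by eventually_elim auto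
      then show False by simp
    qed
  qed
  then have "emeasure P F = 0" by (subst (asm) AE_iff_measurable[OF F]) (use sets.sets_into_space[OF F] in auto)
  moreover have "AE x in Q. x \<in> F"
    using aQ by eventually_elim (auto simp: memF elim: eventually_mono)
  then have "emeasure Q F = 1"
    using F assms(3) by (intro Q.emeasure_eq_1_AE) auto
  ultimately show ?thesis using F assms(3) unfolding orthogonal_measures_def by blast
qed

text \<open>Transfers events about the estimator from the path space to the underlying probability
  space, so that consistency under \<open>M\<close> becomes a statement about the path law.\<close>

lemma measure_path_law_OLS:
  assumes "L > 0" "gaussian_field M Z" and [measurable]: "Measurable.pred borel (R :: real \<Rightarrow> bool)"
  defines "N \<equiv> PiM {0..L} (\<lambda>_. borel :: (real^2) measure)"
  shows "{w \<in> space N. R (OLS L p n (\<lambda>s. w s $ 2) (\<lambda>s. w s $ 1))} \<in> sets N"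
    and "measure (path_law L M Z) {w \<in> space N. R (OLS L p n (\<lambda>s. w s $ 2) (\<lambda>s. w s $ 1))} =
      measure M {\<omega> \<in> space M. R (OLS L p n (\<lambda>s. Z s \<omega> $ 2) (\<lambda>s. Z s \<omega> $ 1))}"
proof -
  have w: "(\<lambda>w. w s) \<in> borel_measurable N" for s
  proof (cases "s \<in> {0..L}")
    case True
    then show ?thesis unfolding N_def by (rule measurable_component_singleton)
  next
    \<comment> \<open>Outside \<open>{0..L}\<close> the elements of the product space take the fixed
      value \<open>undefined\<close>, so these evaluations are constant and measurable, as
      \<open>borel_measurable_OLS\<close> asks for every \<open>s\<close>.\<close>
    case False
    then have "w s = undefined" if "w \<in> space N" for w
      using that by (auto simp: N_def space_PiM PiE_def extensional_def)
    then show ?thesis by (subst measurable_cong[where g = "\<lambda>_. undefined"]) auto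
  qed
  have [measurable]: "(\<lambda>w. OLS L p n (\<lambda>s. w s $ 2) (\<lambda>s. w s $ 1)) \<in> borel_measurable N"
    by (intro borel_measurable_OLS borel_measurable_vec_component w)
  show E: "{w \<in> space N. R (OLS L p n (\<lambda>s. w s $ 2) (\<lambda>s. w s $ 1))} \<in> sets N"
    by measurable
  have f: "(\<lambda>\<omega>. \<lambda>s\<in>{0..L}. Z s \<omega>) \<in> measurable M N"
    unfolding N_def using assms(2) by (intro measurable_restrict) (auto simp: gaussian_field_def)
  have "OLS L p n (\<lambda>s. (\<lambda>s\<in>{0..L}. Z s \<omega>) s $ 2) (\<lambda>s. (\<lambda>s\<in>{0..L}. Z s \<omega>) s $ 1) =
      OLS L p n (\<lambda>s. Z s \<omega> $ 2) (\<lambda>s. Z s \<omega> $ 1)" for \<omega>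
    using assms(1) by (intro OLS_cong) auto
  then show "measure (path_law L M Z) {w \<in> space N. R (OLS L p n (\<lambda>s. w s $ 2) (\<lambda>s. w s $ 1))} =
      measure M {\<omega> \<in> space M. R (OLS L p n (\<lambda>s. Z s \<omega> $ 2) (\<lambda>s. Z s \<omega> $ 1))}"
    unfolding path_law_def N_def[symmetric] measure_distr[OF f E]
    using measurable_space[OF f] by (intro arg_cong[where f = "measure M"]) auto
qed

theorem theorem1:
  fixes M :: "'a measure" and Z :: "real \<Rightarrow> 'a \<Rightarrow> real^2" and K :: "real \<Rightarrow> real^2^2"
    and L :: real and c \<alpha> :: "real^2^2" and \<beta> :: real
  assumes "L > 0"
    and "stationary_gaussian_field M Z K"
    and "regression_covariance L K c \<alpha> \<beta>"
  shows "(\<forall>(M' :: 'b measure) Z' K' c' \<alpha>' \<beta>'.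
           stationary_gaussian_field M' Z' K' \<longrightarrow>
           regression_covariance L K' c' \<alpha>' \<beta>' \<longrightarrow>
           \<beta> \<noteq> \<beta>' \<longrightarrow>
           orthogonal_measures (path_law L M Z) (path_law L M' Z')) \<and>
         (\<forall>p::nat. \<alpha> $ 1 $ 1 < 2 * real p \<longrightarrow>
           converges_in_probability M
             (\<lambda>n \<omega>. OLS L p n (\<lambda>s. Z s \<omega> $ 2) (\<lambda>s. Z s \<omega> $ 1)) \<beta>)"
proof (intro conjI allI impI)
  fix p :: nat assume "\<alpha> $ 1 $ 1 < 2 * real p"
  then show "converges_in_probability M (\<lambda>n \<omega>. OLS L p n (\<lambda>s. Z s \<omega> $ 2) (\<lambda>s. Z s \<omega> $ 1)) \<beta>"
    by (rule OLS_consistent[OF assms])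
next
  fix M' :: "'b measure" and Z' K' c' \<alpha>' \<beta>'
  assume A': "stationary_gaussian_field M' Z' K'" "regression_covariance L K' c' \<alpha>' \<beta>'" and ne: "\<beta> \<noteq> \<beta>'"
  \<comment> \<open>The two fields may have different exponents; one order \<open>p\<close> large
    enough for both gives a common statistic.\<close>
  obtain p :: nat where "max (\<alpha> $ 1 $ 1) (\<alpha>' $ 1 $ 1) < real p" using reals_Archimedean2 by blast
  then have p: "\<alpha> $ 1 $ 1 < 2 * real p" "\<alpha>' $ 1 $ 1 < 2 * real p" by auto
  \<comment> \<open>A third of the distance separates the closed neighbourhoods of the two slopes,
    which gives the strict inequality needed below.\<close>
  define \<delta> where "\<delta> = \<bar>\<beta> - \<beta>'\<bar> / 3"
  have \<delta>: "\<delta> > 0" using ne by (simp add: \<delta>_def)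
  have g: "gaussian_field M Z" "gaussian_field M' Z'" and pr: "prob_space M" "prob_space M'"
    using assms(2) A'(1) by (auto simp: stationary_gaussian_field_def)
  interpret M: prob_space M by fact
  interpret M': prob_space M' by fact
  define N where "N = PiM {0..L} (\<lambda>_. borel :: (real^2) measure)"
  define b where "b n w = OLS L p n (\<lambda>s. w s $ 2) (\<lambda>s. w s $ 1)" for n and w :: "real \<Rightarrow> real^2"
  \<comment> \<open>The event that the estimator favours \<open>\<beta>'\<close>: asymptotically
    null under the first law and certain under the second.\<close>
  define E where "E n = {w \<in> space N. \<bar>b n w - \<beta>'\<bar> \<le> \<delta>}" for n
  have conv: "converges_in_probability M (\<lambda>n \<omega>. b n (\<lambda>s. Z s \<omega>)) \<beta>"
    "converges_in_probability M' (\<lambda>n \<omega>. b n (\<lambda>s. Z' s \<omega>)) \<beta>'"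
    unfolding b_def using OLS_consistent[OF assms p(1)] OLS_consistent[OF assms(1) A' p(2)] by auto
  have mb: "(\<lambda>\<omega>. b n (\<lambda>s. Z s \<omega>)) \<in> borel_measurable M" for n
    using conv(1) by (simp add: converges_in_probability_def)
  have s: "space (path_law L M' Z') = space N" "sets (path_law L M' Z') = sets N" "sets (path_law L M Z) = sets N"
    by (simp_all add: path_law_def N_def)
  have f: "(\<lambda>\<omega>. \<lambda>s\<in>{0..L}. Z s \<omega>) \<in> measurable M N" "(\<lambda>\<omega>. \<lambda>s\<in>{0..L}. Z' s \<omega>) \<in> measurable M' N"
    unfolding N_def using g by (auto intro!: measurable_restrict simp: gaussian_field_def)
  show "orthogonal_measures (path_law L M Z) (path_law L M' Z')"
  proof (rule orthogonal_measuresI)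
    show "prob_space (path_law L M Z)" "prob_space (path_law L M' Z')"
      unfolding path_law_def N_def[symmetric] by (rule M.prob_space_distr[OF f(1)] M'.prob_space_distr[OF f(2)])+
    show "E n \<in> sets (path_law L M Z)" for n
      unfolding s E_def b_def N_def by (rule measure_path_law_OLS(1)[OF assms(1) g(1)]) measurable
    show "(\<lambda>n. measure (path_law L M Z) (E n)) \<longlonglongrightarrow> 0"
    proof (rule tendsto_sandwich[OF _ _ tendsto_const])
      show "(\<lambda>n. measure M {\<omega>\<in>space M. \<bar>b n (\<lambda>s. Z s \<omega>) - \<beta>\<bar> > \<delta>}) \<longlonglongrightarrow> 0"
        using conv(1) \<delta> by (simp add: converges_in_probability_def)
      have "measure (path_law L M Z) (E n) \<le> measure M {\<omega>\<in>space M. \<bar>b n (\<lambda>s. Z s \<omega>) - \<beta>\<bar> > \<delta>}" for n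
      proof -
        have "measure (path_law L M Z) (E n) = measure M {\<omega>\<in>space M. \<bar>b n (\<lambda>s. Z s \<omega>) - \<beta>'\<bar> \<le> \<delta>}"
          unfolding E_def b_def N_def by (rule measure_path_law_OLS(2)[OF assms(1) g(1)]) measurable
        also have "\<dots> \<le> measure M {\<omega>\<in>space M. \<bar>b n (\<lambda>s. Z s \<omega>) - \<beta>\<bar> > \<delta>}"
        proof (rule M.finite_measure_mono)
          have "\<delta> < \<bar>x - \<beta>\<bar>" if "\<bar>x - \<beta>'\<bar> \<le> \<delta>" for x
          proof -
            have "3 * \<delta> = \<bar>\<beta> - \<beta>'\<bar>" by (simp add: \<delta>_def)
            then show ?thesis using that \<delta> by linarith
          qed
          then show "{\<omega>\<in>space M. \<bar>b n (\<lambda>s. Z s \<omega>) - \<beta>'\<bar> \<le> \<delta>} \<subseteq>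
              {\<omega>\<in>space M. \<bar>b n (\<lambda>s. Z s \<omega>) - \<beta>\<bar> > \<delta>}" by auto
          show "{\<omega>\<in>space M. \<bar>b n (\<lambda>s. Z s \<omega>) - \<beta>\<bar> > \<delta>} \<in> M.events"
            using mb[of n] by measurable
        qed
        finally show ?thesis .
      qed
      then show "\<forall>\<^sub>F n in sequentially. measure (path_law L M Z) (E n) \<le>
          measure M {\<omega>\<in>space M. \<bar>b n (\<lambda>s. Z s \<omega>) - \<beta>\<bar> > \<delta>}" by simp
    qed auto
    show "(\<lambda>n. measure (path_law L M' Z') (space (path_law L M' Z') - E n)) \<longlonglongrightarrow> 0"
    proof -
      have "space (path_law L M' Z') - E n = {w \<in> space N. \<bar>b n w - \<beta>'\<bar> > \<delta>}" for n
        by (auto simp: s E_def)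
      moreover have "measure (path_law L M' Z') {w \<in> space N. \<bar>b n w - \<beta>'\<bar> > \<delta>} =
          measure M' {\<omega>\<in>space M'. \<bar>b n (\<lambda>s. Z' s \<omega>) - \<beta>'\<bar> > \<delta>}" for n
        unfolding b_def N_def by (rule measure_path_law_OLS(2)[OF assms(1) g(2)]) measurable
      ultimately show ?thesis
        using conv(2) \<delta> by (simp add: converges_in_probability_def)
    qed
  qed (simp add: s)
qed

end
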